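(* Let $S$ be a ring, let $C$ be a multiplicatively closed subset of nonzerodivisors of $S$, and let $R$ be a subring of $S$ that is twisted along $C$ by a $C$-torsion-free $S$-module $K$. Then the rings $R$ and $S$ share the same total ring of quotients, and the extension $R\subseteq S$ is quadratic, and hence integral, but not finite unless $R=S$. If also $S$ is a domain, $K$ is torsion-free and $R$ is strongly twisted by $K$, then $R\subseteq S$ is a subintegral extension.
   Context: All rings are commutative with identity. A derivation $D$ from a ring $B$ to a $B$-module $L$ is an additive map with $D(st)=sD(t)+tD(s)$; it is $C$-linear for a subset $C\subseteq B$ if $D(C)=0$. For a multiplicatively closed set $C$, $S_C$ and $K_C$ denote localizations at $C$. An $S$-module $L$ is $C$-torsion-free if $c\ell=0$ with $c\in C$, $\ell\in L$ implies $\ell=0$. Twisted: let $S$ be a ring, $K$ an $S$-module, and $C$ a multiplicatively closed subset of nonzerodivisors of $S$ that are also nonzerodivisors on $K$. A subring $R$ of $S$ is twisted by $K$ along $C$ if there is a $C$-linear derivation $D:S_C\to K_C$ such that (a) $R=S\cap D^{-1}(K)$; (b) $D(S_C)$ generates $K_C$ as an $S_C$-module; (c) $S\subseteq \operatorname{Ker} D+cS$ for all $c\in C$. Strongly twisted: let $S$ be a domain with quotient field $F$, $K$ a torsion-free $S$-module, and $FK=F\otimes_S K$. A subring $R$ of $S$ is strongly twisted by $K$ if there is a derivation $D:F\to FK$ such that (a) $R=S\cap D^{-1}(K)$; (b) $D(F)$ generates $FK$ as an $F$-vector space; (c) $S\subseteq\operatorname{Ker} D+sS$ for all $0\neq s\in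 S$. An extension $R\subseteq S$ is quadratic if every $R$-submodule of $S$ containing $R$ is a ring; equivalently, $st\in sR+tR+R$ for all $s,t\in S$. It is finite if $S$ is a finitely generated $R$-module. It is subintegral if it is integral, the contraction map $\operatorname{Spec}(S)\to\operatorname{Spec}(R)$ is a bijection, and the induced maps on residue fields are isomorphisms (so $S_P=R_{P\cap R}+PS_P$ for every prime ideal $P$ of $S$). *)

theory Defs
  imports
    "HOL-Algebra.Module" "HOL-Algebra.QuotRing" "HOL-Algebra.Polynomials"
    "HOL-Algebra.Free_Abelian_Groups"
begin

definition regular_module :: "('a, 'm) ring_scheme \<Rightarrow> ('a, 'a) module" where
  "regular_module S =
     \<lparr>carrier = carrier S, monoid.mult = monoid.mult S, one = one S,
      ring.zero = ring.zero S, ring.add = ring.add S, smult = monoid.mult S\<rparr>"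

definition generated_submodule ::
  "('a, 'm) ring_scheme \<Rightarrow> ('a, 'b, 'k) module_scheme \<Rightarrow> 'b set \<Rightarrow> 'b set" where
  "generated_submodule B L U = \<Inter>{N. submodule N B L \<and> U \<subseteq> N}"

definition torsion_free_along ::
  "('a, 'b, 'k) module_scheme \<Rightarrow> 'a set \<Rightarrow> bool" where
  "torsion_free_along L C \<longleftrightarrow>
     (\<forall>c\<in>C. \<forall>l\<in>carrier L. c \<odot>\<^bsub>L\<^esub> l = \<zero>\<^bsub>L\<^esub> \<longrightarrow> l = \<zero>\<^bsub>L\<^esub>)"

definition torsion_free ::
  "('a, 'm) ring_scheme \<Rightarrow> ('a, 'b, 'k) module_scheme \<Rightarrow> bool" where
  "torsion_free S L \<longleftrightarrow> torsion_free_along L (carrier S - {\<zero>\<^bsub>S\<^esub>})"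

definition nonzerodivisors :: "('a, 'm) ring_scheme \<Rightarrow> 'a set" where
  "nonzerodivisors S =
     {c \<in> carrier S. \<forall>x\<in>carrier S. c \<otimes>\<^bsub>S\<^esub> x = \<zero>\<^bsub>S\<^esub> \<longrightarrow> x = \<zero>\<^bsub>S\<^esub>}"

definition loc_rel ::
  "('a, 'b, 'k) module_scheme \<Rightarrow> 'a set \<Rightarrow> (('b \<times> 'a) \<times> ('b \<times> 'a)) set" where
  "loc_rel M C =
     {((m, c), (n, d)). m \<in> carrier M \<and> n \<in> carrier M \<and> c \<in> C \<and> d \<in> C \<and>
        (\<exists>u\<in>C. u \<odot>\<^bsub>M\<^esub> (d \<odot>\<^bsub>M\<^esub> m) = u \<odot>\<^bsub>M\<^esub> (c \<odot>\<^bsub>M\<^esub> n))}"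

definition fraction ::
  "('a, 'b, 'k) module_scheme \<Rightarrow> 'a set \<Rightarrow> 'b \<Rightarrow> 'a \<Rightarrow> ('b \<times> 'a) set" where
  "fraction M C m c = loc_rel M C `` {(m, c)}"

definition ring_fraction ::
  "('a, 'm) ring_scheme \<Rightarrow> 'a set \<Rightarrow> 'a \<Rightarrow> 'a \<Rightarrow> ('a \<times> 'a) set" where
  "ring_fraction S C = fraction (regular_module S) C"

text \<open>The unions below range over all representatives; as the operations do not depend on the
  representatives, all the united sets are equal (cf. \<open>UN_equiv_class2\<close>).\<close>

definition ring_loc :: "('a, 'm) ring_scheme \<Rightarrow> 'a set \<Rightarrow> ('a \<times> 'a) set ring" where
  "ring_loc S C =
     \<lparr>carrier = (carrier S \<times> C) // loc_rel (regular_module S) C,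
      monoid.mult = (\<lambda>U V. \<Union>(a, c)\<in>U. \<Union>(b, d)\<in>V.
               ring_fraction S C (a \<otimes>\<^bsub>S\<^esub> b) (c \<otimes>\<^bsub>S\<^esub> d)),
      one = ring_fraction S C \<one>\<^bsub>S\<^esub> \<one>\<^bsub>S\<^esub>,
      ring.zero = ring_fraction S C \<zero>\<^bsub>S\<^esub> \<one>\<^bsub>S\<^esub>,
      ring.add = (\<lambda>U V. \<Union>(a, c)\<in>U. \<Union>(b, d)\<in>V.
               ring_fraction S C (d \<otimes>\<^bsub>S\<^esub> a \<oplus>\<^bsub>S\<^esub> c \<otimes>\<^bsub>S\<^esub> b) (c \<otimes>\<^bsub>S\<^esub> d))\<rparr>"

text \<open>\<open>K\<^sub>C\<close> as a module over \<open>S\<^sub>C\<close>. The fields \<open>mult\<close> and \<open>one\<close> of the record type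
  are not used by modules.\<close>

definition module_loc ::
  "('a, 'm) ring_scheme \<Rightarrow> 'a set \<Rightarrow> ('a, 'b, 'k) module_scheme
     \<Rightarrow> (('a \<times> 'a) set, ('b \<times> 'a) set) module" where
  "module_loc S C K =
     \<lparr>carrier = (carrier K \<times> C) // loc_rel K C,
      monoid.mult = undefined,
      one = undefined,
      ring.zero = fraction K C \<zero>\<^bsub>K\<^esub> \<one>\<^bsub>S\<^esub>,
      ring.add = (\<lambda>U V. \<Union>(k, c)\<in>U. \<Union>(l, d)\<in>V.
               fraction K C (d \<odot>\<^bsub>K\<^esub> k \<oplus>\<^bsub>K\<^esub> c \<odot>\<^bsub>K\<^esub> l) (c \<otimes>\<^bsub>S\<^esub> d)),
      smult = (\<lambda>U V. \<Union>(a, c)\<in>U. \<Union>(k, d)\<in>V. fraction K C (a \<odot>\<^bsub>K\<^esub> k) (c \<otimes>\<^bsub>S\<^esub> d))\<rparr>"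

text \<open>For a subring \<open>R\<close> of \<open>S\<close> and multiplicatively closed sets \<open>C \<subseteq> D\<close> of \<open>R\<close> and \<open>S\<close>,
  the canonical map \<open>r / c \<mapsto> r / c\<close> from \<open>R\<^sub>C\<close> to \<open>S\<^sub>D\<close>.\<close>

definition ring_loc_map ::
  "('a, 'm) ring_scheme \<Rightarrow> 'a set \<Rightarrow> ('a \<times> 'a) set \<Rightarrow> ('a \<times> 'a) set" where
  "ring_loc_map S D U = the_elem ((\<lambda>(r, c). ring_fraction S D r c) ` U)"

definition total_quotient_ring :: "('a, 'm) ring_scheme \<Rightarrow> ('a \<times> 'a) set ring" where
  "total_quotient_ring S = ring_loc S (nonzerodivisors S)"

definition quotient_field :: "('a, 'm) ring_scheme \<Rightarrow> ('a \<times> 'a) set ring" where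
  "quotient_field S = ring_loc S (carrier S - {\<zero>\<^bsub>S\<^esub>})"

text \<open>The inclusion of \<open>R\<close> in \<open>S\<close> induces an isomorphism of total rings of quotients; the first
  conjunct says that there is an induced map at all.\<close>

definition same_total_quotient_ring :: "'a set \<Rightarrow> ('a, 'm) ring_scheme \<Rightarrow> bool" where
  "same_total_quotient_ring R S \<longleftrightarrow>
     nonzerodivisors (S\<lparr>carrier := R\<rparr>) \<subseteq> nonzerodivisors S \<and>
     ring_loc_map S (nonzerodivisors S)
       \<in> ring_iso (total_quotient_ring (S\<lparr>carrier := R\<rparr>)) (total_quotient_ring S)"

text \<open>For a ring homomorphism \<open>h\<close> from \<open>S\<close> to \<open>B\<close> and an \<open>S\<close>-module \<open>K\<close>, the \<open>B\<close>-module
  \<open>B \<otimes>\<^sub>S K\<close>: the free abelian group on \<open>B \<times> K\<close> modulo the subgroup generated by the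
  bilinearity relations. Note that \<open>free_Abelian_group\<close> is written multiplicatively.\<close>

definition tensor_relations ::
  "('a, 'm) ring_scheme \<Rightarrow> ('a \<Rightarrow> 'f) \<Rightarrow> ('f, 'n) ring_scheme \<Rightarrow> ('a, 'b, 'k) module_scheme
     \<Rightarrow> ('f \<times> 'b \<Rightarrow>\<^sub>0 int) set" where
  "tensor_relations S h B K =
     {frag_of (x \<oplus>\<^bsub>B\<^esub> y, k) - frag_of (x, k) - frag_of (y, k) |x y k.
        x \<in> carrier B \<and> y \<in> carrier B \<and> k \<in> carrier K} \<union>
     {frag_of (x, k \<oplus>\<^bsub>K\<^esub> l) - frag_of (x, k) - frag_of (x, l) |x k l.
        x \<in> carrier B \<and> k \<in> carrier K \<and> l \<in> carrier K} \<union>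
     {frag_of (x \<otimes>\<^bsub>B\<^esub> h s, k) - frag_of (x, s \<odot>\<^bsub>K\<^esub> k) |x s k.
        x \<in> carrier B \<and> s \<in> carrier S \<and> k \<in> carrier K}"

definition tensor_kernel ::
  "('a, 'm) ring_scheme \<Rightarrow> ('a \<Rightarrow> 'f) \<Rightarrow> ('f, 'n) ring_scheme \<Rightarrow> ('a, 'b, 'k) module_scheme
     \<Rightarrow> ('f \<times> 'b \<Rightarrow>\<^sub>0 int) set" where
  "tensor_kernel S h B K =
     generate (free_Abelian_group (carrier B \<times> carrier K)) (tensor_relations S h B K)"

definition pure_tensor ::
  "('a, 'm) ring_scheme \<Rightarrow> ('a \<Rightarrow> 'f) \<Rightarrow> ('f, 'n) ring_scheme \<Rightarrow> ('a, 'b, 'k) module_scheme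
     \<Rightarrow> 'f \<Rightarrow> 'b \<Rightarrow> ('f \<times> 'b \<Rightarrow>\<^sub>0 int) set" where
  "pure_tensor S h B K x k =
     tensor_kernel S h B K #>\<^bsub>free_Abelian_group (carrier B \<times> carrier K)\<^esub> frag_of (x, k)"

definition extend_scalars ::
  "('a, 'm) ring_scheme \<Rightarrow> ('a \<Rightarrow> 'f) \<Rightarrow> ('f, 'n) ring_scheme \<Rightarrow> ('a, 'b, 'k) module_scheme
     \<Rightarrow> ('f, ('f \<times> 'b \<Rightarrow>\<^sub>0 int) set) module" where
  "extend_scalars S h B K =
     (let G = free_Abelian_group (carrier B \<times> carrier K); N = tensor_kernel S h B K in
      \<lparr>carrier = carrier (G Mod N),
       monoid.mult = undefined,
       one = undefined,
       ring.zero = one (G Mod N),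
       ring.add = monoid.mult (G Mod N),
       smult = (\<lambda>x U. \<Union>z\<in>U. N #>\<^bsub>G\<^esub> frag_extend (\<lambda>(y, k). frag_of (x \<otimes>\<^bsub>B\<^esub> y, k)) z)\<rparr>)"

definition derivation ::
  "('a, 'm) ring_scheme \<Rightarrow> ('a, 'b, 'k) module_scheme \<Rightarrow> ('a \<Rightarrow> 'b) \<Rightarrow> bool" where
  "derivation B L D \<longleftrightarrow>
     D \<in> carrier B \<rightarrow> carrier L \<and>
     (\<forall>s\<in>carrier B. \<forall>t\<in>carrier B.
        D (s \<oplus>\<^bsub>B\<^esub> t) = D s \<oplus>\<^bsub>L\<^esub> D t \<and>
        D (s \<otimes>\<^bsub>B\<^esub> t) = s \<odot>\<^bsub>L\<^esub> D t \<oplus>\<^bsub>L\<^esub> t \<odot>\<^bsub>L\<^esub> D s)"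

text \<open>Below, \<open>\<iota>\<close> and \<open>\<kappa>\<close> are the canonical maps along which \<open>S\<close> and \<open>K\<close>
  are regarded as subsets of \<open>S\<^sub>C\<close> and \<open>K\<^sub>C\<close> (resp. of \<open>F\<close> and
  \<open>F \<otimes>\<^sub>S K\<close>); they are injective under the torsion-freeness hypotheses.\<close>

definition twisted_along ::
  "('a, 'm) ring_scheme \<Rightarrow> ('a, 'b, 'k) module_scheme \<Rightarrow> 'a set \<Rightarrow> 'a set \<Rightarrow> bool" where
  "twisted_along S K C R \<longleftrightarrow>
     cring S \<and> module S K \<and> subring R S \<and>
     submonoid C S \<and> C \<subseteq> nonzerodivisors S \<and> torsion_free_along K C \<and>
     (let SC = ring_loc S C; KC = module_loc S C K;
          \<iota> = (\<lambda>s. ring_fraction S C s \<one>\<^bsub>S\<^esub>); \<kappa> = (\<lambda>k. fraction K C k \<one>\<^bsub>S\<^esub>) in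
      \<exists>D. derivation SC KC D \<and>
          (\<forall>c\<in>C. D (\<iota> c) = \<zero>\<^bsub>KC\<^esub>) \<and>
          R = {s \<in> carrier S. D (\<iota> s) \<in> \<kappa> ` carrier K} \<and>
          generated_submodule SC KC (D ` carrier SC) = carrier KC \<and>
          (\<forall>c\<in>C. \<iota> ` carrier S
             \<subseteq> a_kernel SC KC D <+>\<^bsub>SC\<^esub> ((\<lambda>s. \<iota> (c \<otimes>\<^bsub>S\<^esub> s)) ` carrier S)))"

definition strongly_twisted ::
  "('a, 'm) ring_scheme \<Rightarrow> ('a, 'b, 'k) module_scheme \<Rightarrow> 'a set \<Rightarrow> bool" where
  "strongly_twisted S K R \<longleftrightarrow>
     domain S \<and> module S K \<and> torsion_free S K \<and> subring R S \<and>
     (let F = quotient_field S;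
          \<iota> = (\<lambda>s. ring_fraction S (carrier S - {\<zero>\<^bsub>S\<^esub>}) s \<one>\<^bsub>S\<^esub>);
          FK = extend_scalars S \<iota> F K; \<kappa> = pure_tensor S \<iota> F K \<one>\<^bsub>F\<^esub> in
      \<exists>D. derivation F FK D \<and>
          R = {s \<in> carrier S. D (\<iota> s) \<in> \<kappa> ` carrier K} \<and>
          generated_submodule F FK (D ` carrier F) = carrier FK \<and>
          (\<forall>s\<in>carrier S - {\<zero>\<^bsub>S\<^esub>}. \<iota> ` carrier S
             \<subseteq> a_kernel F FK D <+>\<^bsub>F\<^esub> ((\<lambda>t. \<iota> (s \<otimes>\<^bsub>S\<^esub> t)) ` carrier S)))"

definition quadratic_extension :: "'a set \<Rightarrow> ('a, 'm) ring_scheme \<Rightarrow> bool" where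
  "quadratic_extension R S \<longleftrightarrow>
     (\<forall>N. submodule N (S\<lparr>carrier := R\<rparr>) (regular_module S) \<and> R \<subseteq> N \<longrightarrow> subring N S)"

definition finite_extension :: "'a set \<Rightarrow> ('a, 'm) ring_scheme \<Rightarrow> bool" where
  "finite_extension R S \<longleftrightarrow>
     (\<exists>U. finite U \<and> U \<subseteq> carrier S \<and>
        generated_submodule (S\<lparr>carrier := R\<rparr>) (regular_module S) U = carrier S)"

text \<open>Polynomials are coefficient lists, leading coefficient first. The predicate \<open>polynomial\<close>
  is avoided because it excludes the monic polynomials over the zero ring.\<close>

definition integral_extension :: "'a set \<Rightarrow> ('a, 'm) ring_scheme \<Rightarrow> bool" where
  "integral_extension R S \<longleftrightarrow>
     (\<forall>s\<in>carrier S. \<exists>p. p \<noteq> [] \<and> set p \<subseteq> R \<and> lead_coeff p = \<one>\<^bsub>S\<^esub> \<and>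
        ring.eval S p s = \<zero>\<^bsub>S\<^esub>)"

definition Spec :: "('a, 'm) ring_scheme \<Rightarrow> 'a set set" where
  "Spec S = {P. primeideal P S}"

definition local_max_ideal :: "('a, 'm) ring_scheme \<Rightarrow> 'a set \<Rightarrow> ('a \<times> 'a) set set" where
  "local_max_ideal S P = {ring_fraction S (carrier S - P) a c |a c. a \<in> P \<and> c \<in> carrier S - P}"

definition residue_field :: "('a, 'm) ring_scheme \<Rightarrow> 'a set \<Rightarrow> ('a \<times> 'a) set set ring" where
  "residue_field S P = ring_loc S (carrier S - P) Quot local_max_ideal S P"

text \<open>For a prime \<open>P\<close> of \<open>S\<close>, the map from the residue field of a subring \<open>R\<close> at \<open>P \<inter> R\<close> to
  the residue field of \<open>S\<close> at \<open>P\<close> that is induced by the inclusion.\<close>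

definition residue_field_map ::
  "('a, 'm) ring_scheme \<Rightarrow> 'a set \<Rightarrow> ('a \<times> 'a) set set \<Rightarrow> ('a \<times> 'a) set set" where
  "residue_field_map S P V =
     the_elem ((\<lambda>U. local_max_ideal S P
                  +>\<^bsub>ring_loc S (carrier S - P)\<^esub> ring_loc_map S (carrier S - P) U) ` V)"

definition subintegral_extension :: "'a set \<Rightarrow> ('a, 'm) ring_scheme \<Rightarrow> bool" where
  "subintegral_extension R S \<longleftrightarrow>
     integral_extension R S \<and>
     bij_betw (\<lambda>P. P \<inter> R) (Spec S) (Spec (S\<lparr>carrier := R\<rparr>)) \<and>
     (\<forall>P\<in>Spec S. residue_field_map S P
        \<in> ring_iso (residue_field (S\<lparr>carrier := R\<rparr>) (P \<inter> R)) (residue_field S P))"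

end

(* Given s and t in S, choose c in C such that c D s and c D t lie in K, and write s = a + x and
   t = b + y with x, y in c S and D a = D b = 0.  Then D (x y) = x D t + y D s lies in K, so
   (s - a) (t - b) lies in R and the extension is quadratic.  Since D is C-linear, every s also has a
   multiple c s in R, which gives the total quotient ring.  If S is finite over R, one c works for
   all s, and S = R + c S = R.
   In the strongly twisted case S = R + c S for every nonzero c.  Hence a nonzero prime p of R is the
   contraction of exactly one prime of S, namely p + c S for any nonzero c in p, and R maps onto S/P
   for every nonzero prime P of S. *)

theory Submission
  imports Defs
begin

section \<open>Localizations of modules and rings\<close>

text \<open>The derivation along \<open>C\<close> and the derivation of the strong twist live on
  different rings and take values in different modules. They are never compared and meet only in the
  subring R, so each is translated into statements about elements of S. The one along
  \<open>C\<close> gives the quadratic relation, a multiple in R of every s with factor in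
  \<open>C\<close>, and R + cS = S for c in \<open>C\<close>; the other one extends this last
  equation to every nonzero c. The study of Spec then proceeds without derivations. The translation
  of (c) rests on one fact: an element of S killed by D lies in R, because the zero of the target is
  the image of the zero of K. The quadratic relation needs more than this density, namely the kernel
  elements themselves, since subtracting them must leave D s and D t unchanged. The zero prime
  offers no nonzero modulus c. Its residue fields are therefore compared by clearing denominators
  with factors from \<open>C\<close>, which are nonzero because S is a nontrivial ring.\<close>

lemma carrier_regular_module [simp]: "carrier (regular_module S) = carrier S"
  and zero_regular_module [simp]: "\<zero>\<^bsub>regular_module S\<^esub> = \<zero>\<^bsub>S\<^esub>"
  and add_regular_module [simp]: "x \<oplus>\<^bsub>regular_module S\<^esub> y = x \<oplus>\<^bsub>S\<^esub> y"
  and smult_regular_module [simp]: "a \<odot>\<^bsub>regular_module S\<^esub> x = a \<otimes>\<^bsub>S\<^esub> x"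
  by (simp_all add: regular_module_def)

lemma (in cring) module_regular_module: "module R (regular_module R)"
proof (rule moduleI)
  show "abelian_group (regular_module R)"
    by (rule abelian_groupI) (use l_neg in \<open>auto simp: a_ac\<close>)
qed (auto simp: is_cring l_distr r_distr m_assoc)

text \<open>The localized operations are unions over all representatives. This splits their
  evaluation into exhibiting one pair of representatives and showing independence of the
  choice.\<close>

lemma UN_UN_constant_eq:
  assumes "(a, c) \<in> U" and "(b, d) \<in> V"
    and "\<And>a c b d. (a, c) \<in> U \<Longrightarrow> (b, d) \<in> V \<Longrightarrow> f a c b d = Y"
  shows "(\<Union>(a, c)\<in>U. \<Union>(b, d)\<in>V. f a c b d) = Y"
  using assms by fastforce

text \<open>Rings are localized as regular modules over themselves, so one set of formulas serves
  both cases, and multiplication of fractions is an instance of scalar multiplication.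
  \<open>C\<close> is an arbitrary submonoid in order to cover denominators of a twist, all
  nonzerodivisors and complements of primes.\<close>

locale fractions = module R M + C: submonoid C R
  for R (structure) and M (structure) and C
begin

lemma denom_closed: "c \<in> C \<Longrightarrow> c \<in> carrier R"
  using C.subset by blast

lemma loc_rel_iff:
  "((m, c), (n, d)) \<in> loc_rel M C \<longleftrightarrow> m \<in> carrier M \<and> n \<in> carrier M \<and> c \<in> C \<and> d \<in> C \<and>
    (\<exists>u\<in>C. u \<odot>\<^bsub>M\<^esub> (d \<odot>\<^bsub>M\<^esub> m) = u \<odot>\<^bsub>M\<^esub> (c \<odot>\<^bsub>M\<^esub> n))"
  by (auto simp: loc_rel_def)

lemma equiv_loc_rel: "equiv (carrier M \<times> C) (loc_rel M C)"
proof (rule equivI)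
  note [simp] = denom_closed
  show "loc_rel M C \<subseteq> (carrier M \<times> C) \<times> (carrier M \<times> C)"
    by (auto simp: loc_rel_def)
  show "refl_on (carrier M \<times> C) (loc_rel M C)"
    by (auto simp: refl_on_def loc_rel_def intro: C.one_closed)
  show "sym (loc_rel M C)"
    by (rule symI) (auto simp: loc_rel_iff; metis)
  show "trans (loc_rel M C)"
  proof (rule transI, clarify)
    fix m c n d p e
    assume 1: "((m, c), (n, d)) \<in> loc_rel M C" and 2: "((n, d), (p, e)) \<in> loc_rel M C"
    then obtain u v where u: "u \<in> C" "u \<odot>\<^bsub>M\<^esub> (d \<odot>\<^bsub>M\<^esub> m) = u \<odot>\<^bsub>M\<^esub> (c \<odot>\<^bsub>M\<^esub> n)"
      and v: "v \<in> C" "v \<odot>\<^bsub>M\<^esub> (e \<odot>\<^bsub>M\<^esub> n) = v \<odot>\<^bsub>M\<^esub> (d \<odot>\<^bsub>M\<^esub> p)"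
      by (auto simp: loc_rel_iff)
    have mem: "m \<in> carrier M" "n \<in> carrier M" "p \<in> carrier M" "c \<in> C" "d \<in> C" "e \<in> C"
      using 1 2 by (auto simp: loc_rel_iff)
    note mem' = mem u(1) v(1)
    \<comment> \<open>The middle fraction n/d can be eliminated only after multiplying by
      \<open>d\<close>; this extra factor is absorbed into the witness.\<close>
    have "(u \<otimes> v \<otimes> d) \<odot>\<^bsub>M\<^esub> (e \<odot>\<^bsub>M\<^esub> m) = v \<odot>\<^bsub>M\<^esub> (e \<odot>\<^bsub>M\<^esub> (u \<odot>\<^bsub>M\<^esub> (d \<odot>\<^bsub>M\<^esub> m)))"
      using mem' by (simp add: smult_assoc1[symmetric] m_ac)
    also have "\<dots> = u \<odot>\<^bsub>M\<^esub> (c \<odot>\<^bsub>M\<^esub> (v \<odot>\<^bsub>M\<^esub> (e \<odot>\<^bsub>M\<^esub> n)))"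
      unfolding u(2) using mem' by (simp add: smult_assoc1[symmetric] m_ac)
    also have "\<dots> = (u \<otimes> v \<otimes> d) \<odot>\<^bsub>M\<^esub> (c \<odot>\<^bsub>M\<^esub> p)"
      unfolding v(2) using mem' by (simp add: smult_assoc1[symmetric] m_ac)
    finally show "((m, c), (p, e)) \<in> loc_rel M C"
      using mem' by (auto simp: loc_rel_iff intro!: bexI[of _ "u \<otimes> v \<otimes> d"])
  qed
qed

lemma mem_fraction_iff:
  "(n, d) \<in> fraction M C m c \<longleftrightarrow> ((m, c), (n, d)) \<in> loc_rel M C"
  by (simp add: fraction_def)

lemma fraction_eq_iff:
  assumes "m \<in> carrier M" "n \<in> carrier M" "c \<in> C" "d \<in> C"
  shows "fraction M C m c = fraction M C n d \<longleftrightarrow>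
    (\<exists>u\<in>C. u \<odot>\<^bsub>M\<^esub> (d \<odot>\<^bsub>M\<^esub> m) = u \<odot>\<^bsub>M\<^esub> (c \<odot>\<^bsub>M\<^esub> n))"
  unfolding fraction_def using assms
  by (subst eq_equiv_class_iff[OF equiv_loc_rel]) (auto simp: loc_rel_iff)

lemma fraction_eqI:
  assumes "m \<in> carrier M" "n \<in> carrier M" "c \<in> C" "d \<in> C" "d \<odot>\<^bsub>M\<^esub> m = c \<odot>\<^bsub>M\<^esub> n"
  shows "fraction M C m c = fraction M C n d"
  using assms fraction_eq_iff C.one_closed by metis

lemma self_mem_fraction: "m \<in> carrier M \<Longrightarrow> c \<in> C \<Longrightarrow> (m, c) \<in> fraction M C m c"
  by (auto simp: mem_fraction_iff loc_rel_iff intro: C.one_closed)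

lemma carrier_module_loc: "carrier (module_loc R C M) = {fraction M C m c |m c. m \<in> carrier M \<and> c \<in> C}"
  by (auto simp: module_loc_def quotient_def fraction_def)

lemma zero_module_loc: "\<zero>\<^bsub>module_loc R C M\<^esub> = fraction M C \<zero>\<^bsub>M\<^esub> \<one>"
  by (simp add: module_loc_def)

lemma add_module_loc:
  assumes "m \<in> carrier M" "n \<in> carrier M" "c \<in> C" "d \<in> C"
  shows "fraction M C m c \<oplus>\<^bsub>module_loc R C M\<^esub> fraction M C n d =
    fraction M C (d \<odot>\<^bsub>M\<^esub> m \<oplus>\<^bsub>M\<^esub> c \<odot>\<^bsub>M\<^esub> n) (c \<otimes> d)"
proof -
  note [simp] = denom_closed
  have "(\<Union>(k, c)\<in>fraction M C m c. \<Union>(l, d)\<in>fraction M C n d.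
      fraction M C (d \<odot>\<^bsub>M\<^esub> k \<oplus>\<^bsub>M\<^esub> c \<odot>\<^bsub>M\<^esub> l) (c \<otimes> d)) =
    fraction M C (d \<odot>\<^bsub>M\<^esub> m \<oplus>\<^bsub>M\<^esub> c \<odot>\<^bsub>M\<^esub> n) (c \<otimes> d)"
  proof (rule UN_UN_constant_eq[OF self_mem_fraction[OF assms(1,3)] self_mem_fraction[OF assms(2,4)]])
    fix k c' l d'
    assume 1: "(k, c') \<in> fraction M C m c" and 2: "(l, d') \<in> fraction M C n d"
    then obtain u v where u: "u \<in> C" "u \<odot>\<^bsub>M\<^esub> (c' \<odot>\<^bsub>M\<^esub> m) = u \<odot>\<^bsub>M\<^esub> (c \<odot>\<^bsub>M\<^esub> k)"
      and v: "v \<in> C" "v \<odot>\<^bsub>M\<^esub> (d' \<odot>\<^bsub>M\<^esub> n) = v \<odot>\<^bsub>M\<^esub> (d \<odot>\<^bsub>M\<^esub> l)"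
      and mem: "k \<in> carrier M" "l \<in> carrier M" "c' \<in> C" "d' \<in> C"
      by (auto simp: mem_fraction_iff loc_rel_iff)
    note mem = mem assms u(1) v(1)
    have "(u \<otimes> v) \<odot>\<^bsub>M\<^esub> ((c \<otimes> d) \<odot>\<^bsub>M\<^esub> (d' \<odot>\<^bsub>M\<^esub> k \<oplus>\<^bsub>M\<^esub> c' \<odot>\<^bsub>M\<^esub> l)) =
      (v \<otimes> d \<otimes> d') \<odot>\<^bsub>M\<^esub> (u \<odot>\<^bsub>M\<^esub> (c \<odot>\<^bsub>M\<^esub> k)) \<oplus>\<^bsub>M\<^esub> (u \<otimes> c \<otimes> c') \<odot>\<^bsub>M\<^esub> (v \<odot>\<^bsub>M\<^esub> (d \<odot>\<^bsub>M\<^esub> l))"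
      using mem by (simp add: smult_assoc1[symmetric] smult_r_distr m_ac)
    also have "\<dots> = (u \<otimes> v) \<odot>\<^bsub>M\<^esub> ((c' \<otimes> d') \<odot>\<^bsub>M\<^esub> (d \<odot>\<^bsub>M\<^esub> m \<oplus>\<^bsub>M\<^esub> c \<odot>\<^bsub>M\<^esub> n))"
      unfolding u(2)[symmetric] v(2)[symmetric]
      using mem by (simp add: smult_assoc1[symmetric] smult_r_distr m_ac)
    finally show "fraction M C (d' \<odot>\<^bsub>M\<^esub> k \<oplus>\<^bsub>M\<^esub> c' \<odot>\<^bsub>M\<^esub> l) (c' \<otimes> d') =
      fraction M C (d \<odot>\<^bsub>M\<^esub> m \<oplus>\<^bsub>M\<^esub> c \<odot>\<^bsub>M\<^esub> n) (c \<otimes> d)"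
      using mem by (subst fraction_eq_iff) (auto intro!: bexI[of _ "u \<otimes> v"])
  qed
  then show ?thesis
    by (simp add: module_loc_def)
qed

lemma smult_module_loc:
  assumes "a \<in> carrier R" "m \<in> carrier M" "c \<in> C" "d \<in> C"
  shows "ring_fraction R C a c \<odot>\<^bsub>module_loc R C M\<^esub> fraction M C m d =
    fraction M C (a \<odot>\<^bsub>M\<^esub> m) (c \<otimes> d)"
proof -
  note [simp] = denom_closed
  interpret reg: fractions R "regular_module R" C
    by (simp add: fractions_def module_regular_module C.submonoid_axioms)
  have self: "(a, c) \<in> ring_fraction R C a c"
    using assms reg.self_mem_fraction by (simp add: ring_fraction_def)
  have "(\<Union>(a, c)\<in>ring_fraction R C a c. \<Union>(k, d)\<in>fraction M C m d.
      fraction M C (a \<odot>\<^bsub>M\<^esub> k) (c \<otimes> d)) = fraction M C (a \<odot>\<^bsub>M\<^esub> m) (c \<otimes> d)"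
  proof (rule UN_UN_constant_eq[OF self self_mem_fraction[OF assms(2,4)]])
    fix b c' k d'
    assume 1: "(b, c') \<in> ring_fraction R C a c" and 2: "(k, d') \<in> fraction M C m d"
    then obtain u v where u: "u \<in> C" "u \<otimes> (c' \<otimes> a) = u \<otimes> (c \<otimes> b)"
      and v: "v \<in> C" "v \<odot>\<^bsub>M\<^esub> (d' \<odot>\<^bsub>M\<^esub> m) = v \<odot>\<^bsub>M\<^esub> (d \<odot>\<^bsub>M\<^esub> k)"
      and mem: "b \<in> carrier R" "k \<in> carrier M" "c' \<in> C" "d' \<in> C"
      by (auto simp: ring_fraction_def mem_fraction_iff loc_rel_iff reg.mem_fraction_iff reg.loc_rel_iff)
    note mem = mem assms u(1) v(1)
    have "(u \<otimes> v) \<odot>\<^bsub>M\<^esub> ((c \<otimes> d) \<odot>\<^bsub>M\<^esub> (b \<odot>\<^bsub>M\<^esub> k)) = (u \<otimes> (c \<otimes> b)) \<odot>\<^bsub>M\<^esub> (v \<odot>\<^bsub>M\<^esub> (d \<odot>\<^bsub>M\<^esub> k))"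
      using mem by (simp add: smult_assoc1[symmetric] m_ac)
    also have "\<dots> = (u \<otimes> v) \<odot>\<^bsub>M\<^esub> ((c' \<otimes> d') \<odot>\<^bsub>M\<^esub> (a \<odot>\<^bsub>M\<^esub> m))"
      unfolding u(2)[symmetric] v(2)[symmetric]
      using mem by (simp add: smult_assoc1[symmetric] m_ac)
    finally show "fraction M C (b \<odot>\<^bsub>M\<^esub> k) (c' \<otimes> d') = fraction M C (a \<odot>\<^bsub>M\<^esub> m) (c \<otimes> d)"
      using mem by (subst fraction_eq_iff) (auto intro!: bexI[of _ "u \<otimes> v"])
  qed
  then show ?thesis
    by (simp add: module_loc_def)
qed

end

locale ring_fractions = cring R + C: submonoid C R
  for R (structure) and C
begin

sublocale reg: fractions R "regular_module R" C
  by (simp add: fractions_def module_regular_module C.submonoid_axioms)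

lemma ring_fraction_eq_iff:
  assumes "a \<in> carrier R" "b \<in> carrier R" "c \<in> C" "d \<in> C"
  shows "ring_fraction R C a c = ring_fraction R C b d \<longleftrightarrow> (\<exists>u\<in>C. u \<otimes> (d \<otimes> a) = u \<otimes> (c \<otimes> b))"
  using reg.fraction_eq_iff[of a b c d] assms by (simp add: ring_fraction_def)

lemma ring_fraction_eqI:
  assumes "a \<in> carrier R" "b \<in> carrier R" "c \<in> C" "d \<in> C" "d \<otimes> a = c \<otimes> b"
  shows "ring_fraction R C a c = ring_fraction R C b d"
  using assms ring_fraction_eq_iff C.one_closed by metis

lemma mem_ring_fraction_iff:
  "(b, d) \<in> ring_fraction R C a c \<longleftrightarrow> a \<in> carrier R \<and> b \<in> carrier R \<and> c \<in> C \<and> d \<in> C \<and>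
    (\<exists>u\<in>C. u \<otimes> (d \<otimes> a) = u \<otimes> (c \<otimes> b))"
  by (simp add: ring_fraction_def reg.mem_fraction_iff reg.loc_rel_iff)

lemma carrier_ring_loc: "carrier (ring_loc R C) = {ring_fraction R C a c |a c. a \<in> carrier R \<and> c \<in> C}"
  using reg.carrier_module_loc by (simp add: ring_loc_def module_loc_def ring_fraction_def)

lemma ring_fraction_closed:
  "a \<in> carrier R \<Longrightarrow> c \<in> C \<Longrightarrow> ring_fraction R C a c \<in> carrier (ring_loc R C)"
  by (auto simp: carrier_ring_loc)

lemma ring_locE:
  assumes "x \<in> carrier (ring_loc R C)"
  obtains a c where "x = ring_fraction R C a c" "a \<in> carrier R" "c \<in> C"
  using assms by (auto simp: carrier_ring_loc)

lemma zero_ring_loc: "\<zero>\<^bsub>ring_loc R C\<^esub> = ring_fraction R C \<zero> \<one>"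
  and one_ring_loc: "\<one>\<^bsub>ring_loc R C\<^esub> = ring_fraction R C \<one> \<one>"
  by (simp_all add: ring_loc_def)

lemma add_ring_loc:
  assumes "a \<in> carrier R" "b \<in> carrier R" "c \<in> C" "d \<in> C"
  shows "ring_fraction R C a c \<oplus>\<^bsub>ring_loc R C\<^esub> ring_fraction R C b d =
    ring_fraction R C (d \<otimes> a \<oplus> c \<otimes> b) (c \<otimes> d)"
  using reg.add_module_loc[of a b c d] assms
  by (simp add: ring_loc_def module_loc_def ring_fraction_def)

lemma mult_ring_loc:
  assumes "a \<in> carrier R" "b \<in> carrier R" "c \<in> C" "d \<in> C"
  shows "ring_fraction R C a c \<otimes>\<^bsub>ring_loc R C\<^esub> ring_fraction R C b d =
    ring_fraction R C (a \<otimes> b) (c \<otimes> d)"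
  using reg.smult_module_loc[of a b c d] assms
  by (simp add: ring_loc_def module_loc_def ring_fraction_def)

lemma cring_ring_loc: "cring (ring_loc R C)"
proof (rule cringI)
  note [simp] = reg.denom_closed
  show "abelian_group (ring_loc R C)"
  proof (rule abelian_groupI)
    fix x assume "x \<in> carrier (ring_loc R C)"
    then obtain a c where x: "x = ring_fraction R C a c" "a \<in> carrier R" "c \<in> C"
      by (rule ring_locE)
    have "ring_fraction R C (\<ominus> a) c \<oplus>\<^bsub>ring_loc R C\<^esub> x = ring_fraction R C \<zero> (c \<otimes> c)"
      using x by (simp add: add_ring_loc r_distr[symmetric] l_neg)
    also have "\<dots> = \<zero>\<^bsub>ring_loc R C\<^esub>"
      unfolding zero_ring_loc using x by (intro ring_fraction_eqI) auto
    finally have "ring_fraction R C (\<ominus> a) c \<oplus>\<^bsub>ring_loc R C\<^esub> x = \<zero>\<^bsub>ring_loc R C\<^esub>" .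
    then show "\<exists>y\<in>carrier (ring_loc R C). y \<oplus>\<^bsub>ring_loc R C\<^esub> x = \<zero>\<^bsub>ring_loc R C\<^esub>"
      using x ring_fraction_closed a_inv_closed by blast
  qed (auto simp: zero_ring_loc add_ring_loc r_distr m_ac a_ac elim!: ring_locE intro!: ring_fraction_eqI ring_fraction_closed)
  show "comm_monoid (ring_loc R C)"
    by (rule comm_monoidI) (auto simp: one_ring_loc mult_ring_loc m_ac elim!: ring_locE intro!: ring_fraction_eqI ring_fraction_closed)
next
  fix x y z
  assume "x \<in> carrier (ring_loc R C)" "y \<in> carrier (ring_loc R C)" "z \<in> carrier (ring_loc R C)"
  then show "(x \<oplus>\<^bsub>ring_loc R C\<^esub> y) \<otimes>\<^bsub>ring_loc R C\<^esub> z =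
      x \<otimes>\<^bsub>ring_loc R C\<^esub> z \<oplus>\<^bsub>ring_loc R C\<^esub> y \<otimes>\<^bsub>ring_loc R C\<^esub> z"
    by (elim ring_locE, simp add: add_ring_loc mult_ring_loc, intro ring_fraction_eqI)
      (auto simp: l_distr r_distr m_ac)
qed

end

section \<open>Maps between localizations\<close>

lemma (in cring) cring_subring: "subring A R \<Longrightarrow> cring (R\<lparr>carrier := A\<rparr>)"
  using subcring_iff subcringI' subringE(1) by blast

text \<open>Two denominator sets are kept because the comparison maps go from a localization of the
  subring at its own denominators to one of \<open>S\<close> at a larger set: nonzerodivisors on
  both sides, or complements of a prime and of its contraction.\<close>

locale subring_fractions = ring_fractions S D for S (structure) and D +
  fixes R C
  assumes subring: "subring R S"
    and submonoid: "submonoid C (S\<lparr>carrier := R\<rparr>)"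
    and denoms: "C \<subseteq> D"
begin

sublocale sub: ring_fractions "S\<lparr>carrier := R\<rparr>" C
  by (intro ring_fractions.intro cring_subring subring submonoid)

lemma subring_closed: "r \<in> R \<Longrightarrow> r \<in> carrier S"
  using subringE(1)[OF subring] by blast

lemma denom_mem: "c \<in> C \<Longrightarrow> c \<in> D"
  using denoms by blast

lemma denom_mem_subring: "c \<in> C \<Longrightarrow> c \<in> R"
  using sub.C.subset by auto

text \<open>A witness \<open>u\<close> for equality of fractions over the subring is still a witness
  in \<open>D\<close>. Hence all representatives of a class have the same image, and
  \<open>the_elem\<close> is applied to a singleton.\<close>

lemma ring_loc_map_fraction:
  assumes "r \<in> R" "c \<in> C"
  shows "ring_loc_map S D (ring_fraction (S\<lparr>carrier := R\<rparr>) C r c) = ring_fraction S D r c"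
proof -
  note [simp] = reg.denom_closed subring_closed denom_mem denom_mem_subring
  let ?g = "\<lambda>(q, d). ring_fraction S D q d"
  have "(r, c) \<in> ring_fraction (S\<lparr>carrier := R\<rparr>) C r c"
    using assms by (auto simp: sub.mem_ring_fraction_iff intro: sub.C.one_closed)
  moreover have "?g y = ?g (r, c)" if y: "y \<in> ring_fraction (S\<lparr>carrier := R\<rparr>) C r c" for y
  proof -
    obtain q d where qd: "y = (q, d)"
      by (rule prod.exhaust)
    have "\<exists>u\<in>C. u \<otimes> (d \<otimes> r) = u \<otimes> (c \<otimes> q)" and mem: "q \<in> R" "d \<in> C"
      using iffD1[OF sub.mem_ring_fraction_iff y[unfolded qd]] by simp_all
    then obtain u where "u \<in> C" "u \<otimes> (d \<otimes> r) = u \<otimes> (c \<otimes> q)"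
      by blast
    then have "ring_fraction S D q d = ring_fraction S D r c"
      using assms mem by (intro iffD2[OF ring_fraction_eq_iff] bexI[of _ u]) simp_all
    then show ?thesis
      by (simp add: qd)
  qed
  ultimately have "the_elem (?g ` ring_fraction (S\<lparr>carrier := R\<rparr>) C r c) = ?g (r, c)"
    by (intro the_elem_image_unique) blast+
  then show ?thesis
    by (simp add: ring_loc_map_def)
qed

lemma ring_loc_map_hom:
  "ring_loc_map S D \<in> ring_hom (ring_loc (S\<lparr>carrier := R\<rparr>) C) (ring_loc S D)"
proof (rule ring_hom_memI)
  note [simp] = reg.denom_closed subring_closed denom_mem denom_mem_subring
  have one: "\<one> \<in> C"
    using sub.C.one_closed by simp
  then have one': "\<one> \<in> R"
    by simp
  have closed: "a \<otimes> b \<in> R" "a \<oplus> b \<in> R" if "a \<in> R" "b \<in> R" for a b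
    using that subringE(6,7)[OF subring] by auto
  have closed': "c \<otimes> d \<in> C" if "c \<in> C" "d \<in> C" for c d
    using that sub.C.m_closed by simp
  fix x assume "x \<in> carrier (ring_loc (S\<lparr>carrier := R\<rparr>) C)"
  then obtain a c where x: "x = ring_fraction (S\<lparr>carrier := R\<rparr>) C a c" "a \<in> R" "c \<in> C"
    by (auto simp: sub.carrier_ring_loc)
  then show "ring_loc_map S D x \<in> carrier (ring_loc S D)"
    by (simp add: ring_loc_map_fraction ring_fraction_closed)
  fix y assume "y \<in> carrier (ring_loc (S\<lparr>carrier := R\<rparr>) C)"
  then obtain b d where y: "y = ring_fraction (S\<lparr>carrier := R\<rparr>) C b d" "b \<in> R" "d \<in> C"
    by (auto simp: sub.carrier_ring_loc)
  show "ring_loc_map S D (x \<otimes>\<^bsub>ring_loc (S\<lparr>carrier := R\<rparr>) C\<^esub> y) =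
      ring_loc_map S D x \<otimes>\<^bsub>ring_loc S D\<^esub> ring_loc_map S D y"
    using x y by (simp add: sub.mult_ring_loc mult_ring_loc ring_loc_map_fraction closed closed')
  show "ring_loc_map S D (x \<oplus>\<^bsub>ring_loc (S\<lparr>carrier := R\<rparr>) C\<^esub> y) =
      ring_loc_map S D x \<oplus>\<^bsub>ring_loc S D\<^esub> ring_loc_map S D y"
    using x y by (simp add: sub.add_ring_loc add_ring_loc ring_loc_map_fraction closed closed')
next
  have "\<one> \<in> C"
    using sub.C.one_closed by simp
  then show "ring_loc_map S D \<one>\<^bsub>ring_loc (S\<lparr>carrier := R\<rparr>) C\<^esub> = \<one>\<^bsub>ring_loc S D\<^esub>"
    by (simp add: sub.one_ring_loc one_ring_loc ring_loc_map_fraction denom_mem_subring)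
qed

end

section \<open>Nonzerodivisors and total rings of quotients\<close>

lemma nonzerodivisorsI:
  assumes "c \<in> carrier S" "\<And>x. x \<in> carrier S \<Longrightarrow> c \<otimes>\<^bsub>S\<^esub> x = \<zero>\<^bsub>S\<^esub> \<Longrightarrow> x = \<zero>\<^bsub>S\<^esub>"
  shows "c \<in> nonzerodivisors S"
  using assms by (simp add: nonzerodivisors_def)

lemma nonzerodivisorsD:
  assumes "c \<in> nonzerodivisors S"
  shows "c \<in> carrier S" and "x \<in> carrier S \<Longrightarrow> c \<otimes>\<^bsub>S\<^esub> x = \<zero>\<^bsub>S\<^esub> \<Longrightarrow> x = \<zero>\<^bsub>S\<^esub>"
  using assms unfolding nonzerodivisors_def by blast+

lemma (in cring) submonoid_nonzerodivisors: "submonoid (nonzerodivisors R) R"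
proof (rule submonoid.intro)
  show "x \<otimes> y \<in> nonzerodivisors R" if "x \<in> nonzerodivisors R" "y \<in> nonzerodivisors R" for x y
  proof (rule nonzerodivisorsI)
    fix z assume "z \<in> carrier R" "x \<otimes> y \<otimes> z = \<zero>"
    then show "z = \<zero>"
      using that nonzerodivisorsD m_assoc m_closed by metis
  qed (use that nonzerodivisorsD(1)[of _ R] in \<open>blast intro: m_closed\<close>)
  show "nonzerodivisors R \<subseteq> carrier R"
    by (auto dest: nonzerodivisorsD(1))
  show "\<one> \<in> nonzerodivisors R"
    by (rule nonzerodivisorsI) simp_all
qed

lemma (in cring) nonzerodivisors_cancel:
  assumes "c \<in> nonzerodivisors R" "x \<in> carrier R" "y \<in> carrier R" "c \<otimes> x = c \<otimes> y"
  shows "x = y"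
proof -
  have c: "c \<in> carrier R"
    using assms(1) by (rule nonzerodivisorsD)
  then have "c \<otimes> (x \<ominus> y) = \<zero>"
    using assms by (simp add: minus_eq r_distr r_minus r_neg)
  then have "x \<ominus> y = \<zero>"
    using assms by - (rule nonzerodivisorsD(2)[OF assms(1)], simp_all)
  then show ?thesis
    using assms(2,3) by simp
qed

text \<open>Replacing s by a multiple c s in \<open>A\<close> does two jobs. A nonzerodivisor e of
  \<open>A\<close> remains one in \<open>R\<close>, since e s = 0 forces e (c s) = 0 inside
  \<open>A\<close> and c can be cancelled; and every fraction s/d can be rewritten with both entries
  in \<open>A\<close>.\<close>

lemma (in cring) same_total_quotient_ringI:
  assumes A: "subring A R" and C: "C \<subseteq> nonzerodivisors R" "C \<subseteq> A"
    and denominator: "\<And>s. s \<in> carrier R \<Longrightarrow> \<exists>c\<in>C. c \<otimes> s \<in> A"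
  shows "same_total_quotient_ring A R"
proof -
  let ?D = "nonzerodivisors R" and ?E = "nonzerodivisors (R\<lparr>carrier := A\<rparr>)"
  have A_closed: "a \<in> carrier R" if "a \<in> A" for a
    using subringE(1)[OF A] that by blast
  note D_closed = nonzerodivisorsD(1)[of _ R]
  have E: "?E = A \<inter> ?D"
  proof (intro equalityI subsetI IntI)
    fix e assume e: "e \<in> ?E"
    then show "e \<in> A"
      using nonzerodivisorsD(1) by fastforce
    show "e \<in> ?D"
    proof (rule nonzerodivisorsI)
      fix s assume s: "s \<in> carrier R" "e \<otimes> s = \<zero>"
      obtain c where c: "c \<in> C" "c \<otimes> s \<in> A"
        using denominator s by blast
      have "e \<otimes> (c \<otimes> s) = c \<otimes> (e \<otimes> s)"
        using s \<open>e \<in> A\<close> c C A_closed by (intro m_lcomm) auto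
      also have "\<dots> = \<zero>"
        using s c C A_closed by auto
      finally have "c \<otimes> s = \<zero>"
        using nonzerodivisorsD(2)[OF e] c by simp
      then show "s = \<zero>"
        using nonzerodivisorsD(2)[of c R s] c C s by blast
    qed (use \<open>e \<in> A\<close> A_closed in auto)
  next
    fix e assume "e \<in> A \<inter> ?D"
    then have "e \<in> A" "\<And>x. x \<in> A \<Longrightarrow> e \<otimes> x = \<zero> \<Longrightarrow> x = \<zero>"
      using A_closed nonzerodivisorsD(2)[of e R] by blast+
    then show "e \<in> ?E"
      by (intro nonzerodivisorsI) simp_all
  qed
  interpret A: cring "R\<lparr>carrier := A\<rparr>"
    by (rule cring_subring[OF A])
  interpret subring_fractions R ?D A ?E
  proof (intro subring_fractions.intro ring_fractions.intro subring_fractions_axioms.intro)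
    show "?E \<subseteq> ?D"
      using E by blast
  qed (fact is_cring submonoid_nonzerodivisors A A.submonoid_nonzerodivisors)+
  note [simp] = reg.denom_closed subring_closed denom_mem denom_mem_subring
  let ?f = "ring_loc_map R ?D"
  have "inj_on ?f (carrier (ring_loc (R\<lparr>carrier := A\<rparr>) ?E))"
  proof (rule inj_onI)
    fix x y
    assume "x \<in> carrier (ring_loc (R\<lparr>carrier := A\<rparr>) ?E)" "y \<in> carrier (ring_loc (R\<lparr>carrier := A\<rparr>) ?E)"
    then obtain a c b d where x: "x = ring_fraction (R\<lparr>carrier := A\<rparr>) ?E a c" "a \<in> A" "c \<in> ?E"
      and y: "y = ring_fraction (R\<lparr>carrier := A\<rparr>) ?E b d" "b \<in> A" "d \<in> ?E"
      by (auto simp: sub.carrier_ring_loc)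
    assume "?f x = ?f y"
    then obtain u where "u \<in> ?D" "u \<otimes> (d \<otimes> a) = u \<otimes> (c \<otimes> b)"
      using x y by (auto simp: ring_loc_map_fraction ring_fraction_eq_iff)
    then have "d \<otimes> a = c \<otimes> b"
      using x y by - (rule nonzerodivisors_cancel[of u], simp_all)
    then show "x = y"
      unfolding x(1) y(1) using x(2,3) y(2,3) by (intro sub.ring_fraction_eqI) simp_all
  qed
  moreover have "x \<in> ?f ` carrier (ring_loc (R\<lparr>carrier := A\<rparr>) ?E)"
    if x: "x \<in> carrier (ring_loc R ?D)" for x
  proof -
    obtain s d where s: "x = ring_fraction R ?D s d" "s \<in> carrier R" "d \<in> ?D"
      using x by (auto simp: carrier_ring_loc)
    obtain c e where c: "c \<in> C" "c \<otimes> s \<in> A" and e: "e \<in> C" "e \<otimes> d \<in> A"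
      using denominator s D_closed by meson
    have mem: "c \<in> ?D" "e \<in> ?D" "c \<in> A" "e \<in> A" "c \<in> carrier R" "e \<in> carrier R" "d \<in> carrier R"
      using c e C s D_closed by auto
    \<comment> \<open>The fraction s/d is expanded by the product of \<open>c\<close> and
      \<open>e\<close>: the first brings the numerator into \<open>A\<close>, the second the
      denominator, and each is itself in \<open>A\<close>, so it does not spoil the other
      entry.\<close>
    let ?a = "e \<otimes> (c \<otimes> s)" and ?b = "c \<otimes> (e \<otimes> d)"
    have a: "?a \<in> A" and "?b \<in> A" "?b \<in> ?D"
      using c e s mem subringE(6)[OF A] C.m_closed by simp_all
    then have b: "?b \<in> ?E"
      using E by blast
    have "x = ring_fraction R ?D ?a ?b"
      unfolding s(1) using s a b mem by (intro ring_fraction_eqI) (auto simp: m_ac)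
    also have "\<dots> = ?f (ring_fraction (R\<lparr>carrier := A\<rparr>) ?E ?a ?b)"
      using a b by (simp add: ring_loc_map_fraction)
    finally show ?thesis
      using a b by (auto simp: sub.carrier_ring_loc)
  qed
  ultimately have "bij_betw ?f (carrier (ring_loc (R\<lparr>carrier := A\<rparr>) ?E)) (carrier (ring_loc R ?D))"
    using ring_hom_closed[OF ring_loc_map_hom] by (auto simp: bij_betw_def)
  then show ?thesis
    using E ring_loc_map_hom
    by (auto simp: same_total_quotient_ring_def total_quotient_ring_def ring_iso_def)
qed

section \<open>Contracted primes and the maximal ideal of the localization at a prime\<close>

lemma (in primeideal) submonoid_complement: "submonoid (carrier R - I) R"
  by (rule submonoid.intro) (use I_prime I_notcarr one_imp_carrier in auto)

lemma (in cring) primeideal_Int_subring: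
  assumes A: "subring A R" and "primeideal P R"
  shows "primeideal (P \<inter> A) (R\<lparr>carrier := A\<rparr>)"
proof -
  interpret P: primeideal P R
    by fact
  interpret A: cring "R\<lparr>carrier := A\<rparr>"
    by (rule cring_subring[OF A])
  have A_closed: "a \<in> carrier R" if "a \<in> A" for a
    using subringE(1)[OF A] that by blast
  have "subgroup (P \<inter> A) (add_monoid (R\<lparr>carrier := A\<rparr>))"
  proof (rule A.add.subgroupI)
    fix a assume a: "a \<in> P \<inter> A"
    \<comment> \<open>Additive inverses are described relative to the carrier, so for the restricted
      carrier they must be matched by uniqueness.\<close>
    then have "\<ominus>\<^bsub>R\<lparr>carrier := A\<rparr>\<^esub> a = \<ominus> a"
      using A_closed A.a_inv_closed[of a] A.l_neg[of a] by (intro minus_equality[symmetric]) auto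
    then show "\<ominus>\<^bsub>R\<lparr>carrier := A\<rparr>\<^esub> a \<in> P \<inter> A"
      using a subringE(5)[OF A] P.a_inv_closed by simp
  next
    show "P \<inter> A \<noteq> {}"
      using subringE(2)[OF A] additive_subgroup.zero_closed[OF P.is_additive_subgroup] by blast
  qed (use subringE(7)[OF A] in auto)
  then have "additive_subgroup (P \<inter> A) (R\<lparr>carrier := A\<rparr>)"
    by (rule additive_subgroup.intro)
  then show ?thesis
  proof (rule primeidealI2)
    show "carrier (R\<lparr>carrier := A\<rparr>) \<noteq> P \<inter> A"
      using subringE(3)[OF A] P.I_notcarr P.one_imp_carrier by auto
  qed (use A_closed P.I_prime P.I_l_closed P.I_r_closed subringE(6)[OF A] A.is_cring in auto)
qed

text \<open>By definition only some representative of the class has its numerator in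
  \<open>I\<close>. Cross-multiplying puts u q a in \<open>I\<close>, and primeness strips the
  factors \<open>u\<close> and \<open>q\<close>, which lie outside \<open>I\<close>.\<close>

lemma (in primeideal) ring_fraction_mem_local_max_ideal_iff:
  assumes "a \<in> carrier R" "c \<in> carrier R - I"
  shows "ring_fraction R (carrier R - I) a c \<in> local_max_ideal R I \<longleftrightarrow> a \<in> I"
proof
  interpret ring_fractions R "carrier R - I"
    by (simp add: ring_fractions_def is_cring submonoid_complement)
  assume "ring_fraction R (carrier R - I) a c \<in> local_max_ideal R I"
  then obtain p q where "p \<in> I" "q \<in> carrier R - I"
    "ring_fraction R (carrier R - I) a c = ring_fraction R (carrier R - I) p q"
    unfolding local_max_ideal_def by blast
  then obtain u where u: "u \<in> carrier R - I" "u \<otimes> (q \<otimes> a) = u \<otimes> (c \<otimes> p)"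
    using assms ring_fraction_eq_iff[of a p c q] by auto
  have "u \<otimes> (q \<otimes> a) \<in> I"
    unfolding u(2) using \<open>p \<in> I\<close> assms u(1) by (simp add: I_l_closed)
  then show "a \<in> I"
    using I_prime u(1) \<open>q \<in> carrier R - I\<close> assms m_closed by (metis DiffE)
qed (use assms in \<open>auto simp: local_max_ideal_def\<close>)

lemma (in primeideal) ideal_local_max_ideal:
  "ideal (local_max_ideal R I) (ring_loc R (carrier R - I))"
proof -
  interpret ring_fractions R "carrier R - I"
    by (simp add: ring_fractions_def is_cring submonoid_complement)
  let ?D = "carrier R - I"
  interpret L: cring "ring_loc R ?D"
    by (rule cring_ring_loc)
  have zero: "ring_fraction R ?D \<zero> \<one> \<in> local_max_ideal R I"
    using C.one_closed by (subst ring_fraction_mem_local_max_ideal_iff) auto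
  have sub: "local_max_ideal R I \<subseteq> carrier (ring_loc R ?D)"
    using a_subset by (auto simp: local_max_ideal_def carrier_ring_loc)
  have mult: "y \<otimes>\<^bsub>ring_loc R ?D\<^esub> x \<in> local_max_ideal R I"
    if x: "x \<in> local_max_ideal R I" and y: "y \<in> carrier (ring_loc R ?D)" for x y
  proof -
    obtain p c where "x = ring_fraction R ?D p c" "p \<in> I" "c \<in> ?D"
      using x unfolding local_max_ideal_def by blast
    moreover obtain b d where "y = ring_fraction R ?D b d" "b \<in> carrier R" "d \<in> ?D"
      using y by (rule ring_locE)
    ultimately show ?thesis
      using C.m_closed I_l_closed
      by (simp add: mult_ring_loc ring_fraction_mem_local_max_ideal_iff del: DiffE Diff_iff)
  qed
  show ?thesis
  proof (rule idealI)
    show "subgroup (local_max_ideal R I) (add_monoid (ring_loc R ?D))"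
    proof (rule L.add.subgroupI)
      fix x assume x: "x \<in> local_max_ideal R I"
      then have "\<ominus>\<^bsub>ring_loc R ?D\<^esub> x = (\<ominus>\<^bsub>ring_loc R ?D\<^esub> \<one>\<^bsub>ring_loc R ?D\<^esub>) \<otimes>\<^bsub>ring_loc R ?D\<^esub> x"
        using sub by (simp add: L.l_minus subset_iff)
      then show "\<ominus>\<^bsub>ring_loc R ?D\<^esub> x \<in> local_max_ideal R I"
        using mult[OF x] by simp
      fix y assume y: "y \<in> local_max_ideal R I"
      obtain p c where "x = ring_fraction R ?D p c" "p \<in> I" "c \<in> ?D"
        using x unfolding local_max_ideal_def by blast
      moreover obtain q d where "y = ring_fraction R ?D q d" "q \<in> I" "d \<in> ?D"
        using y unfolding local_max_ideal_def by blast
      ultimately show "x \<oplus>\<^bsub>ring_loc R ?D\<^esub> y \<in> local_max_ideal R I"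
        using C.m_closed I_l_closed a_closed
        by (simp add: add_ring_loc ring_fraction_mem_local_max_ideal_iff del: DiffE Diff_iff)
    qed (use sub zero in auto)
  qed (use sub mult L.m_comm in \<open>auto simp: L.ring_axioms subset_iff\<close>)
qed

section \<open>Criteria for extensions\<close>

text \<open>The hypothesis \<open>approx\<close> says that s/d and a/b agree in the residue field of
  \<open>R\<close> at \<open>P\<close>. So the local ring of \<open>A\<close> already maps onto this
  field; the kernel is its maximal ideal, and \<open>residue_field_map\<close> is exactly the map
  induced on the quotient by the first isomorphism theorem.\<close>

lemma (in cring) residue_field_map_iso:
  assumes A: "subring A R" and P: "primeideal P R"
    and approx: "\<And>s d. s \<in> carrier R \<Longrightarrow> d \<in> carrier R - P \<Longrightarrow>
      \<exists>a\<in>A. \<exists>b\<in>A - P. b \<otimes> s \<ominus> a \<otimes> d \<in> P"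
  shows "residue_field_map R P
    \<in> ring_iso (residue_field (R\<lparr>carrier := A\<rparr>) (P \<inter> A)) (residue_field R P)"
proof -
  let ?A = "R\<lparr>carrier := A\<rparr>" and ?D = "carrier R - P"
  let ?C = "carrier ?A - P \<inter> A"
  let ?J = "local_max_ideal R P" and ?I = "local_max_ideal ?A (P \<inter> A)"
  let ?f = "ring_loc_map R ?D" and ?S = "ring_loc R ?D"
  let ?h = "\<lambda>U. ?J +>\<^bsub>?S\<^esub> ?f U"
  have A_closed: "a \<in> carrier R" if "a \<in> A" for a
    using subringE(1)[OF A] that by blast
  interpret P: primeideal P R
    by (rule P)
  interpret PA: primeideal "P \<inter> A" ?A
    by (rule primeideal_Int_subring[OF A P])
  have C_sub: "?C \<subseteq> ?D"
    using A_closed by auto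
  interpret subring_fractions R ?D A ?C
  proof (intro subring_fractions.intro ring_fractions.intro subring_fractions_axioms.intro)
    show "submonoid ?D R" "submonoid ?C ?A"
      by (fact P.submonoid_complement PA.submonoid_complement)+
  qed (fact is_cring A C_sub)+
  interpret L: cring ?S
    by (rule cring_ring_loc)
  interpret J: ideal ?J ?S
    by (rule P.ideal_local_max_ideal)
  have hom: "?h \<in> ring_hom (ring_loc ?A ?C) (?S Quot ?J)"
    using ring_hom_trans[OF ring_loc_map_hom J.rcos_ring_hom] by (simp add: comp_def)
  interpret h: ring_hom_ring "ring_loc ?A ?C" "?S Quot ?J" ?h
    by (intro ring_hom_ringI2 hom J.quotient_is_ring cring.axioms(1)[OF sub.cring_ring_loc])
  have "?h ` carrier (ring_loc ?A ?C) = carrier (?S Quot ?J)"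
  proof (rule equalityI)
    show "carrier (?S Quot ?J) \<subseteq> ?h ` carrier (ring_loc ?A ?C)"
    proof
      fix V assume "V \<in> carrier (?S Quot ?J)"
      then obtain x where V: "V = ?J +>\<^bsub>?S\<^esub> x" "x \<in> carrier ?S"
        by (auto simp: FactRing_def A_RCOSETS_def')
      obtain s d where x: "x = ring_fraction R ?D s d" "s \<in> carrier R" "d \<in> ?D"
        using V(2) by (rule ring_locE)
      obtain a b where a: "a \<in> A" and b: "b \<in> A - P" and ab: "b \<otimes> s \<ominus> a \<otimes> d \<in> P"
        using approx x by blast
      \<comment> \<open>This is the difference s/d - a/b over the common denominator.\<close>
      define j where "j = ring_fraction R ?D (b \<otimes> s \<ominus> a \<otimes> d) (b \<otimes> d)"
      have b': "b \<in> ?C" "b \<in> ?D"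
        using b A_closed by auto
      have mem: "a \<in> carrier R" "b \<in> carrier R" "d \<in> carrier R" "b \<otimes> d \<in> ?D"
        using a b' x(3) A_closed C.m_closed by auto
      have "j \<in> ?J"
        unfolding j_def using ab mem(4) by (auto simp: local_max_ideal_def)
      have "d \<otimes> (b \<otimes> (b \<otimes> s \<ominus> a \<otimes> d) \<oplus> b \<otimes> d \<otimes> a) = b \<otimes> d \<otimes> b \<otimes> s"
        using mem x(2) by algebra
      then have "ring_fraction R ?D (b \<otimes> (b \<otimes> s \<ominus> a \<otimes> d) \<oplus> b \<otimes> d \<otimes> a) (b \<otimes> d \<otimes> b) = x"
        unfolding x(1) using mem x(2,3) b'(2) C.m_closed
        by (intro ring_fraction_eqI) (simp_all del: Diff_iff)
      then have "x = j \<oplus>\<^bsub>?S\<^esub> ring_fraction R ?D a b"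
        unfolding j_def using mem x(2) b'(2) by (subst add_ring_loc) simp_all
      then have "x \<in> ?J +>\<^bsub>?S\<^esub> ring_fraction R ?D a b"
        using \<open>j \<in> ?J\<close> by (auto simp: a_r_coset_def')
      then have "V = ?J +>\<^bsub>?S\<^esub> ring_fraction R ?D a b"
        unfolding V(1) using mem b'(2)
        by (intro J.a_repr_independence'[symmetric] ring_fraction_closed)
      also have "\<dots> = ?h (ring_fraction ?A ?C a b)"
        using ring_loc_map_fraction[OF a b'(1)] by simp
      finally show "V \<in> ?h ` carrier (ring_loc ?A ?C)"
        using sub.ring_fraction_closed[of a b] a b'(1) by auto
    qed
  qed (use ring_hom_closed[OF hom] in auto)
  then have iso: "(\<lambda>V. the_elem (?h ` V)) \<in> ring_iso (ring_loc ?A ?C Quot a_kernel (ring_loc ?A ?C) (?S Quot ?J) ?h) (?S Quot ?J)"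
    by (rule h.FactRing_iso_set)
  have h_zero: "?h x = \<zero>\<^bsub>?S Quot ?J\<^esub> \<longleftrightarrow> x \<in> ?I" if x_mem: "x \<in> carrier (ring_loc ?A ?C)" for x
  proof -
    obtain a c where x: "x = ring_fraction ?A ?C a c" "a \<in> carrier ?A" "c \<in> ?C"
      using x_mem by (rule sub.ring_locE)
    have "?h x = \<zero>\<^bsub>?S Quot ?J\<^esub> \<longleftrightarrow> ?f x \<in> ?J"
      using J.a_rcos_const J.a_rcos_self ring_hom_closed[OF ring_loc_map_hom x_mem]
      by (auto simp: FactRing_def)
    also have "\<dots> \<longleftrightarrow> ring_fraction R ?D a c \<in> ?J"
      unfolding x(1) using x(2,3) by (subst ring_loc_map_fraction) auto
    also have "\<dots> \<longleftrightarrow> a \<in> P"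
      using x C_sub A_closed by (intro P.ring_fraction_mem_local_max_ideal_iff) auto
    also have "\<dots> \<longleftrightarrow> x \<in> ?I"
      unfolding x(1) using PA.ring_fraction_mem_local_max_ideal_iff[OF x(2,3)] x(2) by simp
    finally show ?thesis .
  qed
  have "?I \<subseteq> carrier (ring_loc ?A ?C)"
    using ideal.Icarr[OF PA.ideal_local_max_ideal] by blast
  then have "a_kernel (ring_loc ?A ?C) (?S Quot ?J) ?h = ?I"
    unfolding a_kernel_def' using h_zero by blast
  then show ?thesis
    using iso by (simp add: residue_field_def residue_field_map_def[abs_def])
qed

section \<open>Elementwise criteria for quadratic, integral and finite extensions\<close>

lemma (in cring) quadratic_extensionI:
  assumes A: "subring A R"
    and quadratic: "\<And>s t. s \<in> carrier R \<Longrightarrow> t \<in> carrier R \<Longrightarrow>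
      \<exists>a\<in>A. \<exists>b\<in>A. \<exists>c\<in>A. s \<otimes> t = a \<otimes> s \<oplus> b \<otimes> t \<oplus> c"
  shows "quadratic_extension A R"
  unfolding quadratic_extension_def
proof (intro allI impI, elim conjE)
  fix N assume N: "submodule N (R\<lparr>carrier := A\<rparr>) (regular_module R)" and "A \<subseteq> N"
  interpret N: submodule N "R\<lparr>carrier := A\<rparr>" "regular_module R"
    by (rule N)
  have N_closed: "x \<in> carrier R" if "x \<in> N" for x
    using N.subset that by auto
  have add: "x \<oplus> y \<in> N" if "x \<in> N" "y \<in> N" for x y
    using N.m_closed[OF that] by simp
  have smult: "a \<otimes> x \<in> N" if "a \<in> A" "x \<in> N" for a x
    using N.smult_closed[of a x] that by simp
  show "subring N R"
  proof (rule subringI)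
    show "\<one> \<in> N"
      using subringE(3)[OF A] \<open>A \<subseteq> N\<close> by blast
    show "\<ominus> x \<in> N" if "x \<in> N" for x
    proof -
      have "\<ominus> \<one> \<in> A"
        using subringE(3,5)[OF A] by blast
      then show ?thesis
        using smult[of "\<ominus> \<one>" x] that N_closed by (simp add: l_minus)
    qed
    show "x \<otimes> y \<in> N" if "x \<in> N" "y \<in> N" for x y
      using quadratic[of x y] that N_closed add smult \<open>A \<subseteq> N\<close> by (metis subsetD)
  qed (use N_closed add in auto)
qed

lemma (in cring) integral_extensionI:
  assumes A: "subring A R"
    and quadratic: "\<And>s. s \<in> carrier R \<Longrightarrow> \<exists>a\<in>A. \<exists>b\<in>A. s \<otimes> s = a \<otimes> s \<oplus> b"
  shows "integral_extension A R"
  unfolding integral_extension_def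
proof
  fix s assume s: "s \<in> carrier R"
  then obtain a b where a: "a \<in> A" "b \<in> A" and eq: "s \<otimes> s = a \<otimes> s \<oplus> b"
    using quadratic by blast
  have ab: "a \<in> carrier R" "b \<in> carrier R"
    using a subringE(1)[OF A] by auto
  have "eval [\<one>, \<ominus> a, \<ominus> b] s = s \<otimes> s \<ominus> (a \<otimes> s \<oplus> b)"
    using s ab by (simp add: numeral_2_eq_2) algebra
  also have "\<dots> = \<zero>"
    using s ab by (simp add: eq)
  finally show "\<exists>p. p \<noteq> [] \<and> set p \<subseteq> A \<and> lead_coeff p = \<one> \<and> eval p s = \<zero>"
    using a subringE(3,5)[OF A] by (intro exI[of _ "[\<one>, \<ominus> a, \<ominus> b]"]) auto
qed

text \<open>The product of denominators of finitely many generators works for all of them because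
  \<open>C\<close> lies in \<open>A\<close>. The elements that a fixed c multiplies into
  \<open>A\<close> form an \<open>A\<close>-submodule, so clearing the generators is enough.\<close>

lemma (in cring) finite_extension_common_denominator:
  assumes A: "subring A R" and C: "submonoid C R" "C \<subseteq> A"
    and denominator: "\<And>s. s \<in> carrier R \<Longrightarrow> \<exists>c\<in>C. c \<otimes> s \<in> A"
    and fin: "finite_extension A R"
  shows "\<exists>c\<in>C. \<forall>s\<in>carrier R. c \<otimes> s \<in> A"
proof -
  interpret C: submonoid C R
    by (rule C)
  have A_closed: "a \<in> carrier R" if "a \<in> A" for a
    using subringE(1)[OF A] that by blast
  obtain U where U: "finite U" "U \<subseteq> carrier R"
    and gen: "generated_submodule (R\<lparr>carrier := A\<rparr>) (regular_module R) U = carrier R"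
    using fin by (auto simp: finite_extension_def)
  have "\<exists>c\<in>C. \<forall>u\<in>U. c \<otimes> u \<in> A"
    using U
  proof (induction U rule: finite_induct)
    case empty
    then show ?case
      using C.one_closed by blast
  next
    case (insert u U)
    then obtain c d where c: "c \<in> C" "\<forall>u\<in>U. c \<otimes> u \<in> A" and d: "d \<in> C" "d \<otimes> u \<in> A"
      using denominator by (meson insert_subset)
    have mem: "c \<in> A" "d \<in> A" "c \<in> carrier R" "d \<in> carrier R"
      using c d C A_closed by auto
    have "(c \<otimes> d) \<otimes> v \<in> A" if v: "v \<in> insert u U" for v
    proof (cases "v = u")
      case True
      then show ?thesis
        using mem d insert.prems subringE(6)[OF A] by (simp add: m_assoc)
    next
      case False
      then have "c \<otimes> v \<in> A" "v \<in> carrier R"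
        using c v insert.prems by auto
      moreover have "(c \<otimes> d) \<otimes> v = d \<otimes> (c \<otimes> v)"
        using mem \<open>v \<in> carrier R\<close> by (simp add: m_ac)
      ultimately show ?thesis
        using mem subringE(6)[OF A] by simp
    qed
    then show ?case
      using c d by blast
  qed
  then obtain c where c: "c \<in> C" "\<forall>u\<in>U. c \<otimes> u \<in> A"
    by blast
  have c': "c \<in> carrier R"
    using c C A_closed by blast
  let ?N = "{s \<in> carrier R. c \<otimes> s \<in> A}"
  have "submodule ?N (R\<lparr>carrier := A\<rparr>) (regular_module R)"
  proof (intro submodule.intro submodule_axioms.intro)
    interpret M: module R "regular_module R"
      by (rule module_regular_module)
    \<comment> \<open>Negation of \<open>regular_module R\<close> belongs to another record; the
      scalar -1 identifies it with negation in \<open>R\<close>.\<close>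
    have "\<ominus>\<^bsub>regular_module R\<^esub> x = \<ominus> x" if "x \<in> carrier R" for x
      using M.smult_l_minus[of \<one> x] that by (simp add: l_minus)
    then show "subgroup ?N (add_monoid (regular_module R))"
      using c' subringE(2,5,7)[OF A]
      by (intro M.add.subgroupI) (auto simp: r_minus r_distr)
    show "a \<odot>\<^bsub>regular_module R\<^esub> x \<in> ?N" if "a \<in> carrier (R\<lparr>carrier := A\<rparr>)" "x \<in> ?N" for a x
      using that c' A_closed subringE(6)[OF A] m_lcomm[of c a x] by auto
  qed
  then have "generated_submodule (R\<lparr>carrier := A\<rparr>) (regular_module R) U \<subseteq> ?N"
    using U c unfolding generated_submodule_def by blast
  then show ?thesis
    using c(1) gen by blast
qed

section \<open>Twisted subrings\<close>

text \<open>Condition (c) provides a kernel element only in the localization. As a difference of s/1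
  and (c t)/1 it is the image of s - c t, hence comes from the ring itself. \<open>L\<close> and
  \<open>D\<close> stay arbitrary so that both kinds of twist can use this.\<close>

lemma (in ring_fractions) kernel_decomposition:
  assumes "s \<in> carrier R" "c \<in> carrier R"
    and "ring_fraction R C s \<one> \<in> a_kernel (ring_loc R C) L D <+>\<^bsub>ring_loc R C\<^esub>
      ((\<lambda>t. ring_fraction R C (c \<otimes> t) \<one>) ` carrier R)"
  shows "\<exists>a\<in>carrier R. \<exists>t\<in>carrier R. D (ring_fraction R C a \<one>) = \<zero>\<^bsub>L\<^esub> \<and> s = a \<oplus> c \<otimes> t"
proof -
  interpret L: cring "ring_loc R C"
    by (rule cring_ring_loc)
  obtain x t where x: "x \<in> carrier (ring_loc R C)" "D x = \<zero>\<^bsub>L\<^esub>" and t: "t \<in> carrier R"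
    and eq: "ring_fraction R C s \<one> = x \<oplus>\<^bsub>ring_loc R C\<^esub> ring_fraction R C (c \<otimes> t) \<one>"
    using assms(3) by (auto simp: set_add_def' a_kernel_def')
  let ?a = "s \<ominus> c \<otimes> t"
  have s: "s = ?a \<oplus> c \<otimes> t"
    using assms(1,2) t by algebra
  have "ring_fraction R C s \<one> = ring_fraction R C ?a \<one> \<oplus>\<^bsub>ring_loc R C\<^esub> ring_fraction R C (c \<otimes> t) \<one>"
    using assms(1,2) t s by (subst add_ring_loc) simp_all
  then have "x = ring_fraction R C ?a \<one>"
    using eq x(1) assms(1,2) t by (simp add: ring_fraction_closed)
  then show ?thesis
    using x(2) s t assms(1,2) by (intro bexI[of _ ?a] bexI[of _ t]) auto
qed

text \<open>Only the values of \<open>D\<close> at elements s/1 are computed, always through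
  explicit fractions in the target; even adding zero is read off from the addition formula with
  0/1.\<close>

locale fraction_derivation = fractions R M C for R (structure) and M (structure) and C +
  fixes D
  assumes derivation: "derivation (ring_loc R C) (module_loc R C M) D"
    and denominator_const: "c \<in> C \<Longrightarrow> D (ring_fraction R C c \<one>) = \<zero>\<^bsub>module_loc R C M\<^esub>"
begin

sublocale loc: ring_fractions R C
  by (intro ring_fractions.intro is_cring C.submonoid_axioms)

lemma D_fraction:
  assumes "s \<in> carrier R"
  obtains k c where "D (ring_fraction R C s \<one>) = fraction M C k c" "k \<in> carrier M" "c \<in> C"
proof -
  have "D (ring_fraction R C s \<one>) \<in> carrier (module_loc R C M)"
    using derivation loc.ring_fraction_closed[OF assms C.one_closed]
    by (auto simp: derivation_def)
  then show thesis
    using that by (auto simp: carrier_module_loc)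
qed

lemma D_add:
  assumes "s \<in> carrier R" "t \<in> carrier R"
  shows "D (ring_fraction R C (s \<oplus> t) \<one>) =
    D (ring_fraction R C s \<one>) \<oplus>\<^bsub>module_loc R C M\<^esub> D (ring_fraction R C t \<one>)"
proof -
  have "ring_fraction R C (s \<oplus> t) \<one> =
      ring_fraction R C s \<one> \<oplus>\<^bsub>ring_loc R C\<^esub> ring_fraction R C t \<one>"
    using assms by (simp add: loc.add_ring_loc)
  then show ?thesis
    using derivation assms by (simp add: derivation_def loc.ring_fraction_closed)
qed

lemma D_mult:
  assumes "s \<in> carrier R" "t \<in> carrier R"
  shows "D (ring_fraction R C (s \<otimes> t) \<one>) =
    ring_fraction R C s \<one> \<odot>\<^bsub>module_loc R C M\<^esub> D (ring_fraction R C t \<one>) \<oplus>\<^bsub>module_loc R C M\<^esub>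
    ring_fraction R C t \<one> \<odot>\<^bsub>module_loc R C M\<^esub> D (ring_fraction R C s \<one>)"
proof -
  have "ring_fraction R C (s \<otimes> t) \<one> =
      ring_fraction R C s \<one> \<otimes>\<^bsub>ring_loc R C\<^esub> ring_fraction R C t \<one>"
    using assms by (simp add: loc.mult_ring_loc)
  then show ?thesis
    using derivation assms by (simp add: derivation_def loc.ring_fraction_closed)
qed

lemma D_denominator_mult:
  assumes "c \<in> C" "s \<in> carrier R"
    and "D (ring_fraction R C s \<one>) = fraction M C k d" "k \<in> carrier M" "d \<in> C"
  shows "D (ring_fraction R C (c \<otimes> s) \<one>) = fraction M C (c \<odot>\<^bsub>M\<^esub> k) d"
proof -
  note [simp] = denom_closed
  have "D (ring_fraction R C (c \<otimes> s) \<one>) =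
      fraction M C (c \<odot>\<^bsub>M\<^esub> k) d \<oplus>\<^bsub>module_loc R C M\<^esub> fraction M C \<zero>\<^bsub>M\<^esub> \<one>"
    using assms by (simp add: D_mult denominator_const zero_module_loc smult_module_loc)
  also have "\<dots> = fraction M C (c \<odot>\<^bsub>M\<^esub> k) d"
    using assms by (simp add: add_module_loc)
  finally show ?thesis .
qed

lemma D_add_const:
  assumes "a \<in> carrier R" "s \<in> carrier R" "D (ring_fraction R C a \<one>) = \<zero>\<^bsub>module_loc R C M\<^esub>"
  shows "D (ring_fraction R C (a \<oplus> s) \<one>) = D (ring_fraction R C s \<one>)"
proof -
  note [simp] = denom_closed
  obtain k c where "D (ring_fraction R C s \<one>) = fraction M C k c" "k \<in> carrier M" "c \<in> C"
    using assms(2) by (rule D_fraction)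
  then show ?thesis
    using assms by (simp add: D_add zero_module_loc add_module_loc)
qed

end

text \<open>In \<open>dense_kernel\<close>, condition (c) is pulled back to \<open>S\<close>. It
  records that \<open>D\<close> kills the summand \<open>a\<close>, which is stronger than
  membership in \<open>A\<close>: \<open>quadratic\<close> needs s and s - a to have the same
  derivative.\<close>

locale twisted_subring = fraction_derivation S K C D
  for S (structure) and K (structure) and C and D +
  fixes A
  assumes subring: "subring A S"
    and mem_iff: "s \<in> A \<longleftrightarrow> s \<in> carrier S \<and> D (ring_fraction S C s \<one>) \<in> (\<lambda>k. fraction K C k \<one>) ` carrier K"
    and dense_kernel: "\<lbrakk>c \<in> C; s \<in> carrier S\<rbrakk> \<Longrightarrow> \<exists>a\<in>carrier S. \<exists>t\<in>carrier S.
      D (ring_fraction S C a \<one>) = \<zero>\<^bsub>module_loc S C K\<^esub> \<and> s = a \<oplus> c \<otimes> t"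

lemma twisted_along_twisted_subring:
  fixes S (structure)
  assumes "twisted_along S K C A"
  shows "\<exists>D. twisted_subring S K C D A"
proof -
  let ?\<iota> = "\<lambda>s. ring_fraction S C s \<one>" and ?S = "ring_loc S C" and ?K = "module_loc S C K"
  have S: "cring S" "module S K" "submonoid C S" "subring A S"
    using assms by (simp_all add: twisted_along_def)
  obtain D where D: "derivation ?S ?K D" "\<forall>c\<in>C. D (?\<iota> c) = \<zero>\<^bsub>?K\<^esub>"
      "A = {s \<in> carrier S. D (?\<iota> s) \<in> (\<lambda>k. fraction K C k \<one>) ` carrier K}"
    and dense: "\<forall>c\<in>C. ?\<iota> ` carrier S
      \<subseteq> a_kernel ?S ?K D <+>\<^bsub>?S\<^esub> ((\<lambda>s. ?\<iota> (c \<otimes> s)) ` carrier S)"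
    using assms unfolding twisted_along_def Let_def by blast
  interpret ring_fractions S C
    by (intro ring_fractions.intro S)
  have "\<exists>a\<in>carrier S. \<exists>t\<in>carrier S. D (?\<iota> a) = \<zero>\<^bsub>?K\<^esub> \<and> s = a \<oplus> c \<otimes> t"
    if "c \<in> C" "s \<in> carrier S" for c s
    using that dense reg.denom_closed by (intro kernel_decomposition) blast+
  then have "twisted_subring S K C D A"
    using S D by (intro twisted_subring.intro fraction_derivation.intro fractions.intro
        fraction_derivation_axioms.intro twisted_subring_axioms.intro) blast+
  then show ?thesis by blast
qed

context twisted_subring
begin

lemma denominators_subset: "C \<subseteq> A"
  using denom_closed denominator_const by (auto simp: mem_iff zero_module_loc)

text \<open>A denominator of D s is one of s: if D s = k/c, then D (c s) = c k/c = k/1, because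
  \<open>D\<close> kills c.\<close>

lemma ex_denominator:
  assumes "s \<in> carrier S"
  shows "\<exists>c\<in>C. c \<otimes> s \<in> A"
proof -
  obtain k c where k: "D (ring_fraction S C s \<one>) = fraction K C k c" "k \<in> carrier K" "c \<in> C"
    using assms by (rule D_fraction)
  then have "D (ring_fraction S C (c \<otimes> s) \<one>) = fraction K C (c \<odot>\<^bsub>K\<^esub> k) c"
    using assms by (intro D_denominator_mult)
  also have "\<dots> = fraction K C k \<one>"
    using k denom_closed by (intro fraction_eqI) auto
  finally have "c \<otimes> s \<in> A"
    using assms k denom_closed by (auto simp: mem_iff)
  then show ?thesis
    using k(3) by blast
qed

lemma dense:
  assumes "c \<in> C" "s \<in> carrier S"
  shows "\<exists>a\<in>A. \<exists>t\<in>carrier S. s = a \<oplus> c \<otimes> t"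
proof -
  obtain a t where a: "a \<in> carrier S" "D (ring_fraction S C a \<one>) = \<zero>\<^bsub>module_loc S C K\<^esub>"
    and t: "t \<in> carrier S" "s = a \<oplus> c \<otimes> t"
    using dense_kernel[OF assms] by blast
  have "a \<in> A"
    using a by (auto simp: mem_iff zero_module_loc)
  then show ?thesis
    using t by blast
qed

lemma quadratic:
  assumes s: "s \<in> carrier S" and t: "t \<in> carrier S"
  shows "\<exists>a\<in>A. \<exists>b\<in>A. \<exists>r\<in>A. s \<otimes> t = a \<otimes> s \<oplus> b \<otimes> t \<oplus> r"
proof -
  note [simp] = denom_closed
  let ?D = "\<lambda>s. D (ring_fraction S C s \<one>)"
  obtain k c where k: "?D s = fraction K C k c" "k \<in> carrier K" "c \<in> C"
    using s by (rule D_fraction)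
  obtain l d where l: "?D t = fraction K C l d" "l \<in> carrier K" "d \<in> C"
    using t by (rule D_fraction)
  \<comment> \<open>The modulus is the product of both denominators: its factor \<open>d\<close>
    will clear D t in x D t, its factor \<open>c\<close> will clear D s in y D s. The same modulus
    is used for both elements.\<close>
  obtain a s' where a: "a \<in> carrier S" "?D a = \<zero>\<^bsub>module_loc S C K\<^esub>"
    and s': "s' \<in> carrier S" "s = a \<oplus> c \<otimes> d \<otimes> s'"
    using dense_kernel[of "c \<otimes> d" s] s k(3) l(3) by auto
  obtain b t' where b: "b \<in> carrier S" "?D b = \<zero>\<^bsub>module_loc S C K\<^esub>"
    and t': "t' \<in> carrier S" "t = b \<oplus> c \<otimes> d \<otimes> t'"
    using dense_kernel[of "c \<otimes> d" t] t k(3) l(3) by auto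
  define x y where "x = c \<otimes> d \<otimes> s'" and "y = c \<otimes> d \<otimes> t'"
  have xy: "x \<in> carrier S" "y \<in> carrier S" and st: "s = a \<oplus> x" "t = b \<oplus> y"
    using k l s' t' by (simp_all add: x_def y_def)
  have Dx: "?D x = fraction K C k c" and Dy: "?D y = fraction K C l d"
    using D_add_const[OF a(1) xy(1) a(2)] D_add_const[OF b(1) xy(2) b(2)] k l st by simp_all
  \<comment> \<open>One factor of the modulus cancels the denominator in each term, and the rest
    stays in the numerator, so both terms of D (x y) come from \<open>K\<close>.\<close>
  have "x \<odot>\<^bsub>K\<^esub> l = d \<odot>\<^bsub>K\<^esub> ((c \<otimes> s') \<odot>\<^bsub>K\<^esub> l)" "y \<odot>\<^bsub>K\<^esub> k = c \<odot>\<^bsub>K\<^esub> ((d \<otimes> t') \<odot>\<^bsub>K\<^esub> k)"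
    unfolding x_def y_def using k l s' t' by (simp_all add: smult_assoc1[symmetric] m_ac)
  then have "fraction K C (x \<odot>\<^bsub>K\<^esub> l) d = fraction K C ((c \<otimes> s') \<odot>\<^bsub>K\<^esub> l) \<one>"
    "fraction K C (y \<odot>\<^bsub>K\<^esub> k) c = fraction K C ((d \<otimes> t') \<odot>\<^bsub>K\<^esub> k) \<one>"
    using k l s' t' by (intro fraction_eqI; simp)+
  then have "?D (x \<otimes> y) = fraction K C ((c \<otimes> s') \<odot>\<^bsub>K\<^esub> l \<oplus>\<^bsub>K\<^esub> (d \<otimes> t') \<odot>\<^bsub>K\<^esub> k) \<one>"
    using xy k l s' t' by (simp add: D_mult Dx Dy smult_module_loc add_module_loc)
  then have xyA: "x \<otimes> y \<in> A"
    using xy k l s' t' by (simp add: mem_iff)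
  have ab: "a \<in> A" "b \<in> A"
    using a b by (auto simp: mem_iff zero_module_loc)
  then have "x \<otimes> y \<oplus> \<ominus> (a \<otimes> b) \<in> A"
    using xyA subringE(5-7)[OF subring] by simp
  \<comment> \<open>Expansion of x y = (s - a) (t - b); the constant term is x y - a b.\<close>
  moreover have "s \<otimes> t = b \<otimes> s \<oplus> a \<otimes> t \<oplus> (x \<otimes> y \<oplus> \<ominus> (a \<otimes> b))"
    unfolding st using a(1) b(1) xy by algebra
  ultimately show ?thesis
    using ab by blast
qed

end

section \<open>Strongly twisted subrings\<close>

text \<open>This puts the kernel of the derivation into a strongly twisted subring. The additivity
  relation for 0 + 0 = 0 is exactly the negative of the generator at (x, 0), so that generator lies
  in the relation subgroup and its coset is the subgroup itself.\<close>

lemma pure_tensor_zero: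
  fixes S (structure)
  assumes "module S K" and x: "x \<in> carrier B"
  shows "pure_tensor S h B K x \<zero>\<^bsub>K\<^esub> = \<zero>\<^bsub>extend_scalars S h B K\<^esub>"
proof -
  interpret module S K
    by fact
  let ?G = "free_Abelian_group (carrier B \<times> carrier K)" and ?N = "tensor_kernel S h B K"
  define f where "f = frag_of (x, \<zero>\<^bsub>K\<^esub>)"
  have "f \<in> carrier ?G"
    using x by (simp add: f_def)
  have "- f = frag_of (x, \<zero>\<^bsub>K\<^esub> \<oplus>\<^bsub>K\<^esub> \<zero>\<^bsub>K\<^esub>) - frag_of (x, \<zero>\<^bsub>K\<^esub>) - frag_of (x, \<zero>\<^bsub>K\<^esub>)"
    by (simp add: f_def)
  then have rel: "- f \<in> tensor_relations S h B K"
    unfolding tensor_relations_def using x M.zero_closed by blast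
  then have "- f \<in> ?N"
    unfolding tensor_kernel_def by (rule generate.incl)
  moreover have "f \<in> ?N"
    using generate.inv[OF rel, of ?G] x by (simp add: tensor_kernel_def f_def)
  ultimately have closed: "n + f \<in> ?N" "n + - f \<in> ?N" if "n \<in> ?N" for n
    using generate.eng[of n ?G] that unfolding tensor_kernel_def by fastforce+
  have "?N #>\<^bsub>?G\<^esub> f = ?N"
  proof (intro equalityI subsetI)
    fix n assume "n \<in> ?N"
    then have "n + - f \<in> ?N"
      by (rule closed)
    then have "(n + - f) + f \<in> ?N #>\<^bsub>?G\<^esub> f"
      unfolding r_coset_def mult_free_Abelian_group by blast
    then show "n \<in> ?N #>\<^bsub>?G\<^esub> f"
      by simp
  qed (auto simp: r_coset_def closed)
  then show ?thesis
    by (simp add: pure_tensor_def extend_scalars_def f_def Let_def FactGroup_def)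
qed

lemma strongly_twisted_dense:
  fixes S (structure)
  assumes "strongly_twisted S K A" and "c \<in> carrier S" "c \<noteq> \<zero>" "s \<in> carrier S"
  shows "\<exists>a\<in>A. \<exists>t\<in>carrier S. s = a \<oplus> c \<otimes> t"
proof -
  let ?C = "carrier S - {\<zero>}"
  let ?\<iota> = "\<lambda>s. ring_fraction S ?C s \<one>" and ?F = "quotient_field S"
  let ?FK = "extend_scalars S ?\<iota> ?F K"
  have "domain S" and K: "module S K"
    using assms(1) by (simp_all add: strongly_twisted_def)
  interpret domain S
    by fact
  interpret ring_fractions S ?C
    by (intro ring_fractions.intro is_cring primeideal.submonoid_complement zeroprimeideal)
  obtain D where A: "A = {s \<in> carrier S. D (?\<iota> s) \<in> pure_tensor S ?\<iota> ?F K \<one>\<^bsub>?F\<^esub> ` carrier K}"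
    and dense: "\<forall>s\<in>?C. ?\<iota> ` carrier S \<subseteq> a_kernel ?F ?FK D <+>\<^bsub>?F\<^esub> ((\<lambda>t. ?\<iota> (s \<otimes> t)) ` carrier S)"
    using assms(1) unfolding strongly_twisted_def Let_def by blast
  have "?\<iota> s \<in> a_kernel (ring_loc S ?C) ?FK D <+>\<^bsub>ring_loc S ?C\<^esub> ((\<lambda>t. ?\<iota> (c \<otimes> t)) ` carrier S)"
    using dense assms(2-4) unfolding quotient_field_def by blast
  then obtain a t where a: "a \<in> carrier S" "D (?\<iota> a) = \<zero>\<^bsub>?FK\<^esub>" and t: "t \<in> carrier S" "s = a \<oplus> c \<otimes> t"
    using kernel_decomposition[OF assms(4,2)] by blast
  have "\<one>\<^bsub>?F\<^esub> \<in> carrier ?F"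
    unfolding quotient_field_def one_ring_loc
    using ring_fraction_closed[OF one_closed C.one_closed] .
  then have "D (?\<iota> a) = pure_tensor S ?\<iota> ?F K \<one>\<^bsub>?F\<^esub> \<zero>\<^bsub>K\<^esub>"
    by (simp only: a(2) pure_tensor_zero[OF K])
  moreover have "\<zero>\<^bsub>K\<^esub> \<in> carrier K"
    using K by (simp add: module_def abelian_group_def abelian_monoid.zero_closed)
  ultimately have "a \<in> A"
    using a(1) by (simp add: A)
  then show ?thesis
    using t by blast
qed

text \<open>The facts that determine Spec, stated without derivations. \<open>dense\<close> governs
  the nonzero primes, \<open>ex_denominator\<close> gives every nonzero x a nonzero multiple in
  \<open>A\<close>, and \<open>quadratic\<close> supplies integrality.\<close>

locale dense_subring = domain R for R (structure) +
  fixes A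
  assumes subring: "subring A R"
    and dense: "\<lbrakk>c \<in> carrier R; c \<noteq> \<zero>; s \<in> carrier R\<rbrakk> \<Longrightarrow> \<exists>a\<in>A. \<exists>t\<in>carrier R. s = a \<oplus> c \<otimes> t"
    and ex_denominator: "s \<in> carrier R \<Longrightarrow> \<exists>c\<in>A - {\<zero>}. c \<otimes> s \<in> A"
    and quadratic: "s \<in> carrier R \<Longrightarrow> \<exists>a\<in>A. \<exists>b\<in>A. s \<otimes> s = a \<otimes> s \<oplus> b"
begin

lemma subring_closed: "a \<in> A \<Longrightarrow> a \<in> carrier R"
  using subringE(1)[OF subring] by blast

text \<open>For nonzero x in \<open>P\<close>, a nonzero multiple e = c x in \<open>A\<close> lies
  in both \<open>P\<close> and \<open>Q\<close>. Density modulo this e gives x = a + e t, where a =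
  x - e t is in \<open>P\<close> and in \<open>A\<close>, hence in \<open>Q\<close>; so x is in
  \<open>Q\<close>. Inclusions rather than equalities are compared, and injectivity on Spec follows
  by symmetry.\<close>

lemma primeideal_subset:
  assumes "primeideal P R" "primeideal Q R" "P \<inter> A \<subseteq> Q"
  shows "P \<subseteq> Q"
proof
  interpret P: primeideal P R
    by fact
  interpret Q: primeideal Q R
    by fact
  fix x assume x: "x \<in> P"
  then have xR: "x \<in> carrier R"
    by (rule P.a_Hcarr)
  show "x \<in> Q"
  proof (cases "x = \<zero>")
    case True
    then show ?thesis
      using additive_subgroup.zero_closed[OF Q.is_additive_subgroup] by simp
  next
    case False
    obtain c where c: "c \<in> A" "c \<noteq> \<zero>" "c \<otimes> x \<in> A"
      using ex_denominator[OF xR] by blast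
    have cR: "c \<in> carrier R"
      using c subring_closed by blast
    have e: "c \<otimes> x \<in> P" "c \<otimes> x \<in> Q" "c \<otimes> x \<noteq> \<zero>"
      using assms(3) P.I_l_closed[OF x cR] c cR xR False integral_iff by auto
    obtain a t where a: "a \<in> A" "t \<in> carrier R" "x = a \<oplus> c \<otimes> x \<otimes> t"
      using dense[OF _ e(3) xR] cR xR by auto
    have aR: "a \<in> carrier R"
      using a subring_closed by blast
    have et: "c \<otimes> x \<otimes> t \<in> P" "c \<otimes> x \<otimes> t \<in> Q"
      using e a P.I_r_closed Q.I_r_closed by auto
    have "a = x \<oplus> \<ominus> (c \<otimes> x \<otimes> t)"
      using a(2) aR cR xR by (subst a(3)) algebra
    then have "a \<in> P"
      using x et additive_subgroup.a_closed[OF P.is_additive_subgroup]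
        additive_subgroup.a_inv_closed[OF P.is_additive_subgroup] by metis
    then have "a \<in> Q"
      using a(1) assms(3) by blast
    then show ?thesis
      using a(3) et additive_subgroup.a_closed[OF Q.is_additive_subgroup] by metis
  qed
qed

text \<open>Modulo \<open>c\<close> every element of \<open>R\<close> is represented in
  \<open>A\<close>. Hence p + cR inherits closure under multiplication and primeness from
  \<open>p\<close>, once its intersection with \<open>A\<close> is known to be no larger than
  \<open>p\<close>. The zero prime lifts to the zero ideal of the domain.\<close>

lemma primeideal_lift:
  assumes "primeideal p (R\<lparr>carrier := A\<rparr>)"
  shows "\<exists>P. primeideal P R \<and> P \<inter> A = p"
proof (cases "p \<subseteq> {\<zero>}")
  case True
  interpret p: primeideal p "R\<lparr>carrier := A\<rparr>"
    by fact
  have "\<zero> \<in> p"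
    using additive_subgroup.zero_closed[OF p.is_additive_subgroup] by simp
  with True have "{\<zero>} \<inter> A = p"
    using subringE(2)[OF subring] by blast
  then show ?thesis
    using zeroprimeideal by blast
next
  case False
  interpret p: primeideal p "R\<lparr>carrier := A\<rparr>"
    by fact
  obtain c where c: "c \<in> p" "c \<noteq> \<zero>"
    using False by blast
  have p_sub: "x \<in> A" if "x \<in> p" for x
    using p.a_Hcarr[OF that] by simp
  have pR: "x \<in> carrier R" if "x \<in> p" for x
    using that p_sub subring_closed by blast
  have cR: "c \<in> carrier R"
    using c pR by blast
  have p_add: "x \<oplus> y \<in> p" if "x \<in> p" "y \<in> p" for x y
    using additive_subgroup.a_closed[OF p.is_additive_subgroup that] by simp
  have p_mult: "a \<otimes> x \<in> p" if "a \<in> A" "x \<in> p" for a x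
    using p.I_l_closed[of x a] that by simp
  have p_prime: "a \<in> p \<or> b \<in> p" if "a \<in> A" "b \<in> A" "a \<otimes> b \<in> p" for a b
    using p.I_prime[of a b] that by simp
  define P where "P = {a \<oplus> c \<otimes> t |a t. a \<in> p \<and> t \<in> carrier R}"
  have P_sub: "P \<subseteq> carrier R"
    using pR cR by (auto simp: P_def)
  have PI: "a \<oplus> c \<otimes> t \<in> P" if "a \<in> p" "t \<in> carrier R" for a t
    using that by (auto simp: P_def)
  \<comment> \<open>As \<open>t\<close> satisfies a monic quadratic equation over \<open>A\<close>, the square of \<open>c \<otimes> t\<close> lies in \<open>p\<close>.\<close>
  have "c \<otimes> t \<in> p" if t: "t \<in> carrier R" "c \<otimes> t \<in> A" for t
  proof -
    obtain u v where uv: "u \<in> A" "v \<in> A" "t \<otimes> t = u \<otimes> t \<oplus> v"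
      using quadratic t by blast
    have uvR: "u \<in> carrier R" "v \<in> carrier R"
      using uv subring_closed by auto
    have "(c \<otimes> t) \<otimes> (c \<otimes> t) = c \<otimes> c \<otimes> (t \<otimes> t)"
      using cR t by algebra
    also have "\<dots> = (u \<otimes> (c \<otimes> t)) \<otimes> c \<oplus> (v \<otimes> c) \<otimes> c"
      unfolding uv(3) using cR t uvR by algebra
    also have "\<dots> \<in> p"
      using c p_sub p_add p_mult uv t subringE(6)[OF subring] by simp
    finally show ?thesis
      using p_prime t by blast
  qed
  moreover have "c \<otimes> t \<in> A" if "a \<in> p" "t \<in> carrier R" "a \<oplus> c \<otimes> t \<in> A" for a t
  proof -
    have "c \<otimes> t = (a \<oplus> c \<otimes> t) \<oplus> \<ominus> a"
      using that pR cR by algebra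
    then show ?thesis
      using that p_sub subringE(5,7)[OF subring] by metis
  qed
  ultimately have "P \<inter> A \<subseteq> p"
    using p_add unfolding P_def by blast
  moreover have "x \<in> P" if "x \<in> p" for x
    using PI[OF that zero_closed] pR[OF that] cR by simp
  ultimately have contract: "P \<inter> A = p"
    using p_sub by blast
  have "primeideal P R"
  proof (rule primeidealI2)
    show "additive_subgroup P R"
    proof (intro additive_subgroup.intro add.subgroupI)
      show "P \<subseteq> carrier R"
        by (rule P_sub)
      show "P \<noteq> {}"
        using PI[OF c(1) zero_closed] by blast
      fix x assume "x \<in> P"
      then obtain a t where x: "x = a \<oplus> c \<otimes> t" "a \<in> p" "t \<in> carrier R"
        by (auto simp: P_def)
      have "\<ominus> \<one> \<otimes> a \<in> p"
        using x p_mult subringE(3,5)[OF subring] by blast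
      moreover have "\<ominus> x = \<ominus> \<one> \<otimes> a \<oplus> c \<otimes> (\<ominus> t)"
        unfolding x(1) using x(2,3) pR cR by algebra
      ultimately show "\<ominus> x \<in> P"
        using PI x(3) by simp
      fix y assume "y \<in> P"
      then obtain b u where y: "y = b \<oplus> c \<otimes> u" "b \<in> p" "u \<in> carrier R"
        by (auto simp: P_def)
      have "x \<oplus> y = (a \<oplus> b) \<oplus> c \<otimes> (t \<oplus> u)"
        unfolding x(1) y(1) using x(2,3) y(2,3) pR cR by algebra
      then show "x \<oplus> y \<in> P"
        using PI p_add x y by simp
    qed
    have l_closed: "s \<otimes> x \<in> P" if xP: "x \<in> P" and sR: "s \<in> carrier R" for x s
    proof -
      obtain a t where x: "x = a \<oplus> c \<otimes> t" "a \<in> p" "t \<in> carrier R"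
        using xP by (auto simp: P_def)
      obtain b u where s: "s = b \<oplus> c \<otimes> u" "b \<in> A" "u \<in> carrier R"
        using dense[OF cR c(2) sR] by blast
      \<comment> \<open>Only the part \<open>b\<close> of \<open>s\<close> in \<open>A\<close>
        multiplies \<open>a\<close>, which keeps that product in \<open>p\<close>; all other terms
        are multiples of \<open>c\<close>.\<close>
      have "s \<otimes> x = b \<otimes> a \<oplus> c \<otimes> (u \<otimes> a \<oplus> s \<otimes> t)"
        using sR x(2,3) s(2,3) pR cR subring_closed
        unfolding x(1) s(1) by algebra
      then show ?thesis
        using PI p_mult x s sR pR by simp
    qed
    then show "s \<otimes> x \<in> P" "x \<otimes> s \<in> P" if "x \<in> P" "s \<in> carrier R" for x s
      using that P_sub m_comm[of x s] by auto
    show "carrier R \<noteq> P"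
      using contract p.I_notcarr subring_closed by auto
    show "s \<in> P \<or> t \<in> P" if st: "s \<in> carrier R" "t \<in> carrier R" "s \<otimes> t \<in> P" for s t
    proof -
      obtain a s' where s: "s = a \<oplus> c \<otimes> s'" "a \<in> A" "s' \<in> carrier R"
        using dense[OF cR c(2) st(1)] by blast
      obtain b t' where t: "t = b \<oplus> c \<otimes> t'" "b \<in> A" "t' \<in> carrier R"
        using dense[OF cR c(2) st(2)] by blast
      obtain d u where d: "s \<otimes> t = d \<oplus> c \<otimes> u" "d \<in> p" "u \<in> carrier R"
        using st(3) by (auto simp: P_def)
      have R: "a \<in> carrier R" "b \<in> carrier R" "d \<in> carrier R"
        using s t d subring_closed pR by auto
      \<comment> \<open>Modulo \<open>c\<close> the product of the representatives equals s t, so it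
        falls into \<open>P\<close> and \<open>A\<close>, that is, into \<open>p\<close>, where
        primeness is available.\<close>
      have "a \<otimes> b = s \<otimes> t \<oplus> c \<otimes> (\<ominus> (s' \<otimes> t) \<oplus> \<ominus> (a \<otimes> t'))"
        unfolding s(1) t(1) using s(3) t(3) R cR by algebra
      also have "\<dots> = d \<oplus> c \<otimes> (u \<oplus> (\<ominus> (s' \<otimes> t) \<oplus> \<ominus> (a \<otimes> t')))"
        unfolding d(1) using d(3) s(3) t(3) st(2) R cR by algebra
      finally have "a \<otimes> b \<in> P"
        using PI d s(3) t(3) st(2) R by simp
      then have "a \<in> p \<or> b \<in> p"
        using contract p_prime s(2) t(2) subringE(6)[OF subring] by blast
      then show ?thesis
        using PI s t by blast
    qed
  qed (rule is_cring)
  with contract show ?thesis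
    by blast
qed

lemma bij_betw_Spec: "bij_betw (\<lambda>P. P \<inter> A) (Spec R) (Spec (R\<lparr>carrier := A\<rparr>))"
proof (rule bij_betw_imageI)
  show "inj_on (\<lambda>P. P \<inter> A) (Spec R)"
  proof (rule inj_onI)
    fix P Q assume "P \<in> Spec R" "Q \<in> Spec R" "P \<inter> A = Q \<inter> A"
    then show "P = Q"
      using primeideal_subset[of P Q] primeideal_subset[of Q P] by (auto simp: Spec_def)
  qed
  show "(\<lambda>P. P \<inter> A) ` Spec R = Spec (R\<lparr>carrier := A\<rparr>)"
    using primeideal_lift primeideal_Int_subring[OF subring] by (force simp: Spec_def)
qed

text \<open>At the zero prime the two fractions must agree exactly, so denominators are cleared. At
  a nonzero prime any nonzero c in \<open>P\<close> serves as modulus: s and d are congruent to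
  elements a and b of \<open>A\<close> modulo c, hence modulo \<open>P\<close>.\<close>

lemma residue_approximation:
  assumes "primeideal P R" and s: "s \<in> carrier R" and d: "d \<in> carrier R - P"
  shows "\<exists>a\<in>A. \<exists>b\<in>A - P. b \<otimes> s \<ominus> a \<otimes> d \<in> P"
proof (cases "P \<subseteq> {\<zero>}")
  case True
  interpret P: primeideal P R
    by fact
  have zero: "\<zero> \<in> P"
    by (rule additive_subgroup.zero_closed[OF P.is_additive_subgroup])
  obtain c e where c: "c \<in> A" "c \<noteq> \<zero>" "c \<otimes> s \<in> A" and e: "e \<in> A" "e \<noteq> \<zero>" "e \<otimes> d \<in> A"
    using ex_denominator s d by (metis DiffE insertI1)
  have R: "c \<in> carrier R" "e \<in> carrier R" "d \<in> carrier R" "d \<noteq> \<zero>"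
    using c e d subring_closed zero by auto
  \<comment> \<open>The fraction s/d is expanded by c e, so that e (c s) and c (e d) are the entries
    in \<open>A\<close>; the new denominator is nonzero in a domain.\<close>
  have "c \<otimes> (e \<otimes> d) \<otimes> s \<ominus> (e \<otimes> (c \<otimes> s)) \<otimes> d = \<zero>"
    using R s by algebra
  moreover have "c \<otimes> (e \<otimes> d) \<in> A - P" "e \<otimes> (c \<otimes> s) \<in> A"
    using c e R True subringE(6)[OF subring] integral_iff by auto
  ultimately show ?thesis
    using zero by metis
next
  case False
  interpret P: primeideal P R
    by fact
  obtain c where c: "c \<in> P" "c \<noteq> \<zero>"
    using False by blast
  have cR: "c \<in> carrier R"
    using c(1) by (rule P.a_Hcarr)
  obtain a s' where a: "a \<in> A" "s' \<in> carrier R" "s = a \<oplus> c \<otimes> s'"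
    using dense[OF cR c(2) s] by blast
  obtain b d' where b: "b \<in> A" "d' \<in> carrier R" "d = b \<oplus> c \<otimes> d'"
    using dense[OF cR c(2)] d by blast
  have R: "a \<in> carrier R" "b \<in> carrier R"
    using a b subring_closed by auto
  have "b \<notin> P"
    \<comment> \<open>Otherwise d = b + c d' would lie in \<open>P\<close>.\<close>
    using b d c additive_subgroup.a_closed[OF P.is_additive_subgroup] P.I_r_closed by (metis DiffE)
  moreover have "b \<otimes> s \<ominus> a \<otimes> d = c \<otimes> (b \<otimes> s' \<ominus> a \<otimes> d')"
    unfolding a(3) b(3) using a(2) b(2) R cR by algebra
  then have "b \<otimes> s \<ominus> a \<otimes> d \<in> P"
    using c a b R P.I_r_closed by simp
  ultimately show ?thesis
    using a(1) b(1) by blast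
qed

lemma subintegral_extension: "subintegral_extension A R"
  unfolding subintegral_extension_def
  using integral_extensionI[OF subring quadratic] bij_betw_Spec
    residue_field_map_iso[OF subring _ residue_approximation]
  by (simp add: Spec_def)

end

theorem theorem4p1:
  fixes S :: "('a, 'm) ring_scheme" and K :: "('a, 'b, 'k) module_scheme"
    and C R :: "'a set"
  assumes "cring S"
    and "submonoid C S" and "C \<subseteq> nonzerodivisors S"
    and "subring R S"
    and "module S K" and "torsion_free_along K C"
    and "twisted_along S K C R"
  shows "same_total_quotient_ring R S \<and>
    quadratic_extension R S \<and>
    integral_extension R S \<and>
    (finite_extension R S \<longrightarrow> R = carrier S) \<and>
    (domain S \<and> torsion_free S K \<and> strongly_twisted S K R \<longrightarrow> subintegral_extension R S)"
proof -
  obtain D where "twisted_subring S K C D R"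
    using twisted_along_twisted_subring[OF assms(7)] by blast
  then interpret twisted_subring S K C D R .
  \<comment> \<open>For t = s the two linear terms merge, with coefficient a + b.\<close>
  have square: "\<exists>a\<in>R. \<exists>b\<in>R. s \<otimes>\<^bsub>S\<^esub> s = a \<otimes>\<^bsub>S\<^esub> s \<oplus>\<^bsub>S\<^esub> b" if s: "s \<in> carrier S" for s
  proof -
    obtain a b r where R: "a \<in> R" "b \<in> R" "r \<in> R" "s \<otimes>\<^bsub>S\<^esub> s = a \<otimes>\<^bsub>S\<^esub> s \<oplus>\<^bsub>S\<^esub> b \<otimes>\<^bsub>S\<^esub> s \<oplus>\<^bsub>S\<^esub> r"
      using quadratic[OF s s] by blast
    then have "s \<otimes>\<^bsub>S\<^esub> s = (a \<oplus>\<^bsub>S\<^esub> b) \<otimes>\<^bsub>S\<^esub> s \<oplus>\<^bsub>S\<^esub> r"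
      using s subringE(1)[OF subring] by (simp add: l_distr subset_iff)
    then show ?thesis
      using R subringE(7)[OF subring] by blast
  qed
  have "R = carrier S" if "finite_extension R S"
  proof
    obtain c where c: "c \<in> C" "\<forall>s\<in>carrier S. c \<otimes>\<^bsub>S\<^esub> s \<in> R"
      using finite_extension_common_denominator[OF subring assms(2) denominators_subset
          ex_denominator \<open>finite_extension R S\<close>] by blast
    show "carrier S \<subseteq> R"
    proof
      fix s assume "s \<in> carrier S"
      then obtain a t where "a \<in> R" "t \<in> carrier S" "s = a \<oplus>\<^bsub>S\<^esub> c \<otimes>\<^bsub>S\<^esub> t"
        using dense c(1) by blast
      then show "s \<in> R"
        using c(2) subringE(7)[OF subring] by simp
    qed
  qed (rule subringE(1)[OF subring])
  moreover have "subintegral_extension R S" if S: "domain S" "strongly_twisted S K R"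
  proof -
    interpret S: domain S
      by (rule S)
    \<comment> \<open>Zero would annihilate 1, so it is not a nonzerodivisor of a domain. The
      denominators from \<open>C\<close> are thus nonzero, as \<open>dense_subring\<close>
      demands.\<close>
    have "\<zero>\<^bsub>S\<^esub> \<notin> C"
      using assms(3) S.one_not_zero nonzerodivisorsD(2)[of "\<zero>\<^bsub>S\<^esub>" S "\<one>\<^bsub>S\<^esub>"] by auto
    then have "\<exists>c\<in>R - {\<zero>\<^bsub>S\<^esub>}. c \<otimes>\<^bsub>S\<^esub> s \<in> R" if "s \<in> carrier S" for s
      using ex_denominator[OF that] denominators_subset by blast
    \<comment> \<open>Density at every nonzero modulus comes from the strong twist; denominators and
      the quadratic equation come from the twist along \<open>C\<close>.\<close>
    then interpret dense_subring S R
      by (intro dense_subring.intro dense_subring_axioms.intro S.domain_axioms subring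
          strongly_twisted_dense[OF S(2)] square)
    show ?thesis
      by (rule subintegral_extension)
  qed
  ultimately show ?thesis
    using same_total_quotient_ringI[OF subring assms(3) denominators_subset ex_denominator]
      quadratic_extensionI[OF subring quadratic] integral_extensionI[OF subring square]
    by blast
qed

end
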